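(* For the Caching in Matchings problem on bipartite graphs (with $n$ nodes on each side and $k$ matchings), there exists a deterministic online algorithm that is $nk$-competitive, and there exists a randomized online algorithm that is $O(n\log k)$-competitive.
   Context: Caching in Matchings (bipartite version): there are two disjoint node sets $V^{in}$ and $V^{out}$, each of size $n$. Requests arrive online, each being an edge $(u,v)\in V^{in}\times V^{out}$. The algorithm maintains a cache $M$ which is the union of $k$ matchings (equivalently, a set of edges with a proper edge coloring using colors $1,\dots,k$). If a requested edge is in none of the matchings (a miss), the algorithm must insert it into one of the matchings, evicting from that matching the (at most two) edges of that matching incident to its endpoints. The algorithm may also add any edge to any matching at any time, as long as each of the $k$ sets remains a matching; edges may be evicted freely. Each addition of an edge to a matching costs $1$; an edge cannot be moved between matchings except by evicting it and re-inserting it (recoloring), which costs $1$. Competitive ratio: an online algorithm $A$ is $c$-competitive (with $c=c(n,k)$) if there is $d=d(n,k)$ such that for every request sequence $\sigma$, $\mathrm{cost}(A(\sigma))\le c\cdot \mathrm{cost}(OPT(\sigma))+d$, where $OPT(\sigma)$ is the minimum cost of an offline algorithm serving $\sigma$ with $k$ matchings; for randomized algorithms the left side is replaced by the expected cost. *)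

theory Defs
  imports "HOL-Probability.Probability"
begin

(* The two sides V^in and V^out are both indexed by {..<n}: an edge (u, v) joins node u of V^in
   to node v of V^out, so the sides are disjoint by position. *)
type_synonym edge = "nat \<times> nat"

definition edges :: "nat \<Rightarrow> edge set" where
  "edges n = {..<n} \<times> {..<n}"

definition matching :: "nat \<Rightarrow> edge set \<Rightarrow> bool" where
  "matching n F \<longleftrightarrow> F \<subseteq> edges n \<and>
     (\<forall>e\<in>F. \<forall>f\<in>F. e \<noteq> f \<longrightarrow> fst e \<noteq> fst f \<and> snd e \<noteq> snd f)"

(* M c is the matching of colour c; the colours are the numbers below k. *)
type_synonym cache = "nat \<Rightarrow> edge set"

definition valid_cache :: "nat \<Rightarrow> nat \<Rightarrow> cache \<Rightarrow> bool" where
  "valid_cache n k M \<longleftrightarrow> (\<forall>c<k. matching n (M c)) \<and> (\<forall>c\<ge>k. M c = {})"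

definition cached :: "nat \<Rightarrow> cache \<Rightarrow> edge set" where
  "cached k M = (\<Union>c<k. M c)"

(* Number of additions of an edge to a matching when the cache changes from M to M'. Evictions are
   free; an edge that changes its colour is added to its new matching and therefore costs 1. *)
definition step_cost :: "nat \<Rightarrow> cache \<Rightarrow> cache \<Rightarrow> nat" where
  "step_cost k M M' = (\<Sum>c<k. card (M' c - M c))"

(* A schedule gives the cache s i after the first i requests; s 0 is the initial, empty cache.
   Besides inserting a missed edge, each step may change the cache arbitrarily. *)
definition serves :: "nat \<Rightarrow> nat \<Rightarrow> edge list \<Rightarrow> (nat \<Rightarrow> cache) \<Rightarrow> bool" where
  "serves n k \<sigma> s \<longleftrightarrow> s 0 = (\<lambda>c. {}) \<and>
     (\<forall>i\<le>length \<sigma>. valid_cache n k (s i)) \<and>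
     (\<forall>i<length \<sigma>. \<sigma> ! i \<in> cached k (s (Suc i)))"

definition schedule_cost :: "nat \<Rightarrow> edge list \<Rightarrow> (nat \<Rightarrow> cache) \<Rightarrow> nat" where
  "schedule_cost k \<sigma> s = (\<Sum>i<length \<sigma>. step_cost k (s i) (s (Suc i)))"

definition opt_cost :: "nat \<Rightarrow> nat \<Rightarrow> edge list \<Rightarrow> nat" where
  "opt_cost n k \<sigma> = (LEAST x. \<exists>s. serves n k \<sigma> s \<and> schedule_cost k \<sigma> s = x)"

(* A deterministic online algorithm maps the requests seen so far, the current one included, to
   the cache held after serving them. *)
type_synonym algorithm = "edge list \<Rightarrow> cache"

definition run :: "algorithm \<Rightarrow> edge list \<Rightarrow> nat \<Rightarrow> cache" where
  "run A \<sigma> i = A (take i \<sigma>)"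

definition online_algorithm :: "nat \<Rightarrow> nat \<Rightarrow> algorithm \<Rightarrow> bool" where
  "online_algorithm n k A \<longleftrightarrow> (\<forall>\<sigma>\<in>lists (edges n). serves n k \<sigma> (run A \<sigma>))"

definition alg_cost :: "nat \<Rightarrow> algorithm \<Rightarrow> edge list \<Rightarrow> nat" where
  "alg_cost k A \<sigma> = schedule_cost k \<sigma> (run A \<sigma>)"

definition competitive :: "nat \<Rightarrow> nat \<Rightarrow> algorithm \<Rightarrow> real \<Rightarrow> bool" where
  "competitive n k A c \<longleftrightarrow>
     (\<exists>d. \<forall>\<sigma>\<in>lists (edges n). real (alg_cost k A \<sigma>) \<le> c * real (opt_cost n k \<sigma>) + d)"

(* A randomized online algorithm is a probability distribution over deterministic online
   algorithms for which the response to each request sequence is a random variable. On valid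
   algorithms the response takes finitely many values, so the cost of each request sequence is
   then a bounded random variable, and the expectation below is meaningful. *)
definition randomized_algorithm :: "nat \<Rightarrow> nat \<Rightarrow> algorithm measure \<Rightarrow> bool" where
  "randomized_algorithm n k R \<longleftrightarrow> prob_space R \<and>
     (\<forall>A\<in>space R. online_algorithm n k A) \<and>
     (\<forall>\<sigma>\<in>lists (edges n). (\<lambda>A. A \<sigma>) \<in> measurable R (count_space UNIV))"

definition randomized_competitive :: "nat \<Rightarrow> nat \<Rightarrow> algorithm measure \<Rightarrow> real \<Rightarrow> bool" where
  "randomized_competitive n k R c \<longleftrightarrow>
     (\<exists>d. \<forall>\<sigma>\<in>lists (edges n).
        (\<integral>A. real (alg_cost k A \<sigma>) \<partial>R) \<le> c * real (opt_cost n k \<sigma>) + d)"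

end

theory Submission
  imports Defs
begin

text \<open>Both algorithms first maintain a mere edge set of maximum degree at most \<open>k\<close>, ignoring colours,
  which changes only by evictions and the insertion of the requested edge. A miss can then be
  realized in the coloured cache with at most \<open>n\<close> additions, by a Kempe swap along two colours.

  Deterministically, a vertex is flushed when an edge has to be inserted at it while it has degree
  \<open>k\<close>. With \<open>F\<close> and \<open>Q\<close> the edge sets of the algorithm and the optimum, the potential
  \<open>(k - 1) * card F + k * card (Q - F)\<close> shows that there are at most \<open>k\<close> misses per insertion of the
  optimum.

  For the randomized bound every vertex runs a marking algorithm for its incident edges, and an edge
  is cached if both endpoints want it. Evictions are governed by one random ranking of all edges that
  is drawn once: the phases do not depend on it, so by linearity of expectation it can be reused in
  all of them. Each vertex makes at most \<open>2 * (1 + harm k)\<close> expected misses per insertion of the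
  optimum, and each insertion concerns two vertices.\<close>

section \<open>Recolouring\<close>

text \<open>Both sides are merged into one sum type, so that degree bounds and vertex-wise arguments
  need to be stated only once.\<close>

definition star :: "nat + nat \<Rightarrow> edge set" where
  "star w = (case w of Inl u \<Rightarrow> {e. fst e = u} | Inr v \<Rightarrow> {e. snd e = v})"

definition bounded_degree :: "nat \<Rightarrow> nat \<Rightarrow> edge set \<Rightarrow> bool" where
  "bounded_degree n k F \<longleftrightarrow> F \<subseteq> edges n \<and> (\<forall>w. card (F \<inter> star w) \<le> k)"

text \<open>A valid cache may hold an edge in several matchings. Disjointness excludes this, so that
  a vertex sees exactly as many colours as it has edges.\<close>

definition colours :: "nat \<Rightarrow> nat \<Rightarrow> cache \<Rightarrow> edge set \<Rightarrow> bool" where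
  "colours n k M F \<longleftrightarrow> valid_cache n k M \<and> cached k M = F \<and>
     (\<forall>c<k. \<forall>d<k. c \<noteq> d \<longrightarrow> M c \<inter> M d = {})"

lemma star_simps [simp]: "e \<in> star (Inl u) \<longleftrightarrow> fst e = u" "e \<in> star (Inr v) \<longleftrightarrow> snd e = v"
  by (auto simp: star_def)

lemma mem_star_iff: "e \<in> star w \<longleftrightarrow> w = Inl (fst e) \<or> w = Inr (snd e)"
  by (cases w) auto

lemma finite_edges [simp]: "finite (edges n)"
  by (simp add: edges_def)

lemma matching_finite: "matching n F \<Longrightarrow> finite F"
  unfolding matching_def by (metis finite_edges finite_subset)

lemma matching_subset: "matching n F \<Longrightarrow> G \<subseteq> F \<Longrightarrow> matching n G"
  unfolding matching_def by (meson subsetD subset_trans)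

lemma matching_eqI:
  "matching n F \<Longrightarrow> e \<in> F \<Longrightarrow> f \<in> F \<Longrightarrow> fst e = fst f \<or> snd e = snd f \<Longrightarrow> e = f"
  unfolding matching_def by blast

lemma matching_Un:
  assumes "matching n F" "matching n G" "\<And>f g. f \<in> F \<Longrightarrow> g \<in> G \<Longrightarrow> fst f \<noteq> fst g \<and> snd f \<noteq> snd g"
  shows "matching n (F \<union> G)"
  using assms unfolding matching_def by (metis Un_iff Un_least)

lemma matching_inj_fst: "matching n F \<Longrightarrow> inj_on fst F"
  by (intro inj_onI) (blast dest: matching_eqI)

lemma matching_inj_snd: "matching n F \<Longrightarrow> inj_on snd F"
  by (intro inj_onI) (blast dest: matching_eqI)

lemma card_matching_star:
  assumes "matching n F"
  shows "card (F \<inter> star w) \<le> 1"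
proof -
  have "e = f" if "e \<in> F \<inter> star w" "f \<in> F \<inter> star w" for e f
    using that matching_eqI[OF assms, of e f] by (auto simp: mem_star_iff)
  then show ?thesis
    using matching_finite[OF assms] by (simp add: card_le_Suc0_iff_eq)
qed

section \<open>Kempe swaps along two colours\<close>

text \<open>\<open>R\<close> collects the out-nodes on the alternating walk from \<open>v\<close>,
  which leaves each of them by an \<open>A\<close>-edge and enters the next by a
  \<open>B\<close>-edge. Every in-node touched by \<open>X\<close> thus carries an
  \<open>A\<close>-edge, and \<open>u\<close> has none.\<close>

lemma alternating_component:
  assumes A: "matching n A" and B: "matching n B"
    and u: "\<forall>f\<in>A. fst f \<noteq> u" and v: "\<forall>f\<in>B. snd f \<noteq> v"
  obtains X where "X \<subseteq> A \<union> B"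
    and "\<forall>f\<in>X. \<forall>g\<in>(A \<union> B) - X. fst f \<noteq> fst g \<and> snd f \<noteq> snd g"
    and "\<forall>f\<in>A \<union> B. snd f = v \<longrightarrow> f \<in> X" and "\<forall>f\<in>X. fst f \<noteq> u"
proof -
  define r where "r = {(y, y'). \<exists>x. (x, y) \<in> A \<and> (x, y') \<in> B}"
  define R where "R = {y. (v, y) \<in> r\<^sup>*}"
  define X where "X = {f \<in> A \<union> B. snd f \<in> R}"
  have vR: "v \<in> R" by (simp add: R_def)
  have fwd: "y' \<in> R" if "y \<in> R" "(x, y) \<in> A" "(x, y') \<in> B" for x y y'
    using that unfolding R_def r_def by (auto intro: rtrancl_into_rtrancl)
  have bwd: "\<exists>y. y \<in> R \<and> (x, y) \<in> A" if "y' \<in> R" "(x, y') \<in> B" for x y'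
  proof -
    \<comment> \<open>A node of \<open>R\<close> with a \<open>B\<close>-edge differs from
      \<open>v\<close>, hence has a predecessor on the walk. Its \<open>B\<close>-edge is unique, so
      the walk came through \<open>x\<close>.\<close>
    have "y' \<noteq> v" using v that(2) by force
    moreover have "(v, y') \<in> r\<^sup>*" using that(1) by (simp add: R_def)
    ultimately obtain y where y: "(v, y) \<in> r\<^sup>*" "(y, y') \<in> r"
      by (metis rtranclE)
    then obtain x' where x': "(x', y) \<in> A" "(x', y') \<in> B" by (auto simp: r_def)
    then have "x' = x" using matching_eqI[OF B x'(2) that(2)] by simp
    then show ?thesis using y x' by (auto simp: R_def)
  qed
  have tr: "snd g \<in> R"
    if fg: "f \<in> A \<union> B" "g \<in> A \<union> B" and f: "snd f \<in> R" and eq: "fst f = fst g" for f g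
  proof -
    obtain y where y: "y \<in> R" "(fst g, y) \<in> A"
      using fg(1) f bwd[of "snd f" "fst f"] eq by (metis Un_iff prod.collapse)
    show ?thesis
    proof (cases "g \<in> A")
      case True
      then show ?thesis using matching_eqI[OF A y(2), of g] y(1) by (metis fst_conv snd_conv)
    next
      case False
      then show ?thesis using fwd[OF y] fg(2) by (metis Un_iff prod.collapse)
    qed
  qed
  have nu: "fst f \<noteq> u" if f: "f \<in> X" for f
  proof
    assume "fst f = u"
    then have "f \<in> B" using u f by (auto simp: X_def)
    then obtain y where "(fst f, y) \<in> A"
      using bwd[of "snd f" "fst f"] f by (auto simp: X_def)
    then have "(u, y) \<in> A" using \<open>fst f = u\<close> by simp
    then show False using u by force
  qed
  show ?thesis
  proof (rule that[of X])
    show "X \<subseteq> A \<union> B" by (auto simp: X_def)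
    have "fst f \<noteq> fst g \<and> snd f \<noteq> snd g" if "f \<in> X" "g \<in> (A \<union> B) - X" for f g
      using that tr[of f g] by (auto simp: X_def)
    then show "\<forall>f\<in>X. \<forall>g\<in>(A \<union> B) - X. fst f \<noteq> fst g \<and> snd f \<noteq> snd g" by blast
    show "\<forall>f\<in>A \<union> B. snd f = v \<longrightarrow> f \<in> X" using vR by (auto simp: X_def)
    show "\<forall>f\<in>X. fst f \<noteq> u" using nu by blast
  qed
qed

text \<open>\<open>X\<close> shares no endpoint with the rest of \<open>A \<union> B\<close>, so
  exchanging the two colours on it preserves both matchings. Only \<open>e\<close> and the edges of
  \<open>X\<close> count as additions.\<close>

lemma swap_and_insert:
  assumes A: "matching n A" and B: "matching n B" and disj: "A \<inter> B = {}"
    and X: "X \<subseteq> A \<union> B" "\<forall>f\<in>X. \<forall>g\<in>(A \<union> B) - X. fst f \<noteq> fst g \<and> snd f \<noteq> snd g"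
    and e: "e \<in> edges n" "e \<notin> A \<union> B"
    and free: "\<forall>f\<in>(A - X) \<union> (B \<inter> X). fst f \<noteq> fst e \<and> snd f \<noteq> snd e"
  shows "\<exists>A' B'. matching n A' \<and> matching n B' \<and> A' \<inter> B' = {} \<and> A' \<union> B' = insert e (A \<union> B) \<and>
    card (A' - A) + card (B' - B) \<le> Suc (card X)"
proof -
  let ?A = "insert e ((A - X) \<union> (B \<inter> X))" and ?B = "(B - X) \<union> (A \<inter> X)"
  have fin: "finite A" "finite B" using A B by (auto simp: matching_finite)
  have cross: "fst f \<noteq> fst g \<and> snd f \<noteq> snd g" "fst g \<noteq> fst f \<and> snd g \<noteq> snd f"
    if "f \<in> X" "g \<in> A \<union> B" "g \<notin> X" for f g
    using X(2) that by (metis DiffI)+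
  have "matching n {e}" using e by (simp add: matching_def)
  moreover have "matching n ((A - X) \<union> (B \<inter> X))"
    by (rule matching_Un[OF matching_subset[OF A] matching_subset[OF B]])
      (use cross in blast)+
  ultimately have "matching n ({e} \<union> ((A - X) \<union> (B \<inter> X)))"
    by (rule matching_Un) (use free in \<open>metis singletonD\<close>)
  then have "matching n ?A" by simp
  moreover have "matching n ?B"
    by (rule matching_Un[OF matching_subset[OF B] matching_subset[OF A]])
      (use cross in blast)+
  moreover have "?A \<inter> ?B = {}" using disj e by blast
  moreover have "?A \<union> ?B = insert e (A \<union> B)" using X by blast
  moreover have "card (?A - A) + card (?B - B) \<le> Suc (card X)"
  proof -
    have "card (?A - A) \<le> card (insert e (B \<inter> X))"
      by (rule card_mono) (use fin in auto)
    also have "\<dots> \<le> Suc (card (B \<inter> X))" by (simp add: card_insert_le_m1 card_insert_if fin)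
    finally have 1: "card (?A - A) \<le> Suc (card (B \<inter> X))" .
    have 2: "card (?B - B) \<le> card (A \<inter> X)"
      by (rule card_mono) (use fin in auto)
    have "card (B \<inter> X) + card (A \<inter> X) = card ((B \<inter> X) \<union> (A \<inter> X))"
      by (rule card_Un_disjoint[symmetric]) (use fin disj in auto)
    also have "(B \<inter> X) \<union> (A \<inter> X) = X" using X by blast
    finally show ?thesis using 1 2 by linarith
  qed
  ultimately show ?thesis by blast
qed

text \<open>Writing \<open>H\<close> for \<open>A \<union> B\<close> and \<open>X\<close> for the part of \<open>H\<close> reached from the endpoint \<open>v\<close>, both \<open>X\<close>
  and \<open>H - X\<close> are unions of components, and swapping the colours on either of them frees a colour
  for the new edge. As \<open>H\<close> has at most \<open>2 * n - 2\<close> edges, the smaller part has at most \<open>n - 1\<close>.\<close>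

lemma two_colour_insert:
  assumes A: "matching n A" and B: "matching n B" and disj: "A \<inter> B = {}"
    and e: "e \<in> edges n" "e \<notin> A \<union> B"
    and u: "\<forall>f\<in>A. fst f \<noteq> fst e" and v: "\<forall>f\<in>B. snd f \<noteq> snd e"
  shows "\<exists>A' B'. matching n A' \<and> matching n B' \<and> A' \<inter> B' = {} \<and> A' \<union> B' = insert e (A \<union> B) \<and>
    card (A' - A) + card (B' - B) \<le> n"
proof -
  obtain X where X: "X \<subseteq> A \<union> B"
    "\<forall>f\<in>X. \<forall>g\<in>(A \<union> B) - X. fst f \<noteq> fst g \<and> snd f \<noteq> snd g"
    "\<forall>f\<in>A \<union> B. snd f = snd e \<longrightarrow> f \<in> X" "\<forall>f\<in>X. fst f \<noteq> fst e"
    using alternating_component[OF A B u v] by blast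
  let ?Z = "(A \<union> B) - X"
  have fin: "finite A" "finite B" using A B by (auto simp: matching_finite)
  have "card A = card (fst ` A)" using matching_inj_fst[OF A] by (simp add: card_image)
  also have "\<dots> \<le> card ({..<n} - {fst e})"
    by (rule card_mono) (use A u in \<open>force simp: matching_def edges_def\<close>)+
  finally have cA: "card A \<le> n - 1" using e by (auto simp: edges_def)
  have "card B = card (snd ` B)" using matching_inj_snd[OF B] by (simp add: card_image)
  also have "\<dots> \<le> card ({..<n} - {snd e})"
    by (rule card_mono) (use B v in \<open>force simp: matching_def edges_def\<close>)+
  finally have cB: "card B \<le> n - 1" using e by (auto simp: edges_def)
  have "card X + card ?Z = card (A \<union> B)"
    using X(1) fin by (simp add: card_Diff_subset card_mono finite_subset)
  also have "\<dots> \<le> (n - 1) + (n - 1)" using card_Un_le[of A B] cA cB by linarith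
  finally consider "Suc (card X) \<le> n" | "Suc (card ?Z) \<le> n"
    using e by (fastforce simp: edges_def)
  then show ?thesis
  proof cases
    case 1
    have "\<forall>f\<in>(A - X) \<union> (B \<inter> X). fst f \<noteq> fst e \<and> snd f \<noteq> snd e"
      using X u v by blast
    from swap_and_insert[OF A B disj X(1,2) e this] 1 show ?thesis
      by (meson le_trans)
  next
    case 2
    \<comment> \<open>With the roles of \<open>A\<close> and \<open>B\<close> exchanged,
      \<open>e\<close> now enters \<open>B\<close>. Edges of \<open>B \<inter> X\<close> miss
      \<open>fst e\<close> by the choice of \<open>X\<close> and \<open>snd e\<close> by
      \<open>v\<close>; edges of \<open>A \<inter> ?Z\<close> miss \<open>fst e\<close> by
      \<open>u\<close> and \<open>snd e\<close> because they lie outside \<open>X\<close>.\<close>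
    have free: "\<forall>f\<in>(B - ?Z) \<union> (A \<inter> ?Z). fst f \<noteq> fst e \<and> snd f \<noteq> snd e"
      using X u v by blast
    have cl: "\<forall>f\<in>?Z. \<forall>g\<in>(B \<union> A) - ?Z. fst f \<noteq> fst g \<and> snd f \<noteq> snd g"
      using X(1,2) by (metis Diff_iff Un_commute)
    have "?Z \<subseteq> B \<union> A" "B \<inter> A = {}" "e \<notin> B \<union> A" using disj e by auto
    from swap_and_insert[OF B A this(2) this(1) cl e(1) this(3) free] 2 show ?thesis
      by (smt (verit) Int_commute Un_commute add.commute le_trans)
  qed
qed

section \<open>Inserting an edge into a coloured cache\<close>

lemma colours_finite: "colours n k M F \<Longrightarrow> finite (M c)"
  unfolding colours_def valid_cache_def by (metis finite.emptyI matching_finite not_le)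

lemma colours_restrict:
  assumes "colours n k M F"
  shows "colours n k (\<lambda>c. M c \<inter> G) (F \<inter> G)"
  using assms unfolding colours_def valid_cache_def cached_def
  by (intro conjI allI impI) (blast intro: matching_subset)+

text \<open>Pigeonhole: if every colour occurred at \<open>w\<close>, one edge of each colour would
  give \<open>k\<close> distinct edges there, as colour classes are disjoint.\<close>

lemma free_colour:
  assumes M: "colours n k M F" and F: "finite F" and w: "card (F \<inter> star w) < k"
  obtains c where "c < k" "M c \<inter> star w = {}"
proof -
  have "\<exists>c<k. M c \<inter> star w = {}"
  proof (rule ccontr)
    assume "\<not> ?thesis"
    then have "\<forall>c. \<exists>x. c < k \<longrightarrow> x \<in> M c \<inter> star w" by blast
    then obtain f where f: "\<And>c. c < k \<Longrightarrow> f c \<in> M c \<inter> star w" by metis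
    have "inj_on f {..<k}"
    proof (rule inj_onI, rule ccontr)
      fix c d assume cd: "c \<in> {..<k}" "d \<in> {..<k}" "f c = f d" "c \<noteq> d"
      then have "f c \<in> M c \<inter> M d" using f[of c] f[of d] by auto
      then show False using M cd by (auto simp: colours_def)
    qed
    then have "k = card (f ` {..<k})" by (simp add: card_image)
    also have "\<dots> \<le> card (F \<inter> star w)"
      by (rule card_mono) (use F M f in \<open>auto simp: colours_def cached_def\<close>)
    finally show False using w by simp
  qed
  then show ?thesis using that by blast
qed

text \<open>Each endpoint has a free colour. If both have the same one, \<open>e\<close> simply
  takes it; otherwise the two free colours are rearranged by a Kempe swap and all others stay
  untouched.\<close>

lemma colours_insert:
  assumes M: "colours n k M F" and F: "F \<subseteq> edges n"
    and e: "e \<in> edges n" "e \<notin> F"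
    and deg: "\<And>w. e \<in> star w \<Longrightarrow> card (F \<inter> star w) < k"
  shows "\<exists>M'. colours n k M' (insert e F) \<and> step_cost k M M' \<le> n"
proof -
  have finF: "finite F" using F finite_edges finite_subset by blast
  obtain a where a: "a < k" "M a \<inter> star (Inl (fst e)) = {}"
    using free_colour[OF M finF deg[of "Inl (fst e)"]] by auto
  obtain b where b: "b < k" "M b \<inter> star (Inr (snd e)) = {}"
    using free_colour[OF M finF deg[of "Inr (snd e)"]] by auto
  have mat: "matching n (M c)" if "c < k" for c
    using M that by (auto simp: colours_def valid_cache_def)
  have UF: "(\<Union>c<k. M c) = F" using M by (auto simp: colours_def cached_def)
  have dis: "M c \<inter> M d = {}" if "c < k" "d < k" "c \<noteq> d" for c d
    using M that by (auto simp: colours_def)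
  have emp: "M c = {}" if "c \<ge> k" for c using M that by (auto simp: colours_def valid_cache_def)
  show ?thesis
  proof (cases "a = b")
    case True
    let ?M = "M(a := insert e (M a))"
    have "matching n (insert e (M a))"
      using mat[OF a(1)] a(2) b(2) e unfolding True matching_def
      by (auto simp: disjoint_iff) metis+
    then have "valid_cache n k ?M"
      using mat emp a(1) by (auto simp: valid_cache_def)
    moreover have "cached k ?M = insert e F"
      using UF a(1) by (fastforce simp: cached_def split: if_splits)
    moreover have "?M c \<inter> ?M d = {}" if "c < k" "d < k" "c \<noteq> d" for c d
      using dis[OF that] e UF that a(1) by (auto split: if_splits)
    moreover have "step_cost k M ?M \<le> n"
    proof -
      have "step_cost k M ?M = (\<Sum>c<k. if c = a then card (insert e (M a) - M a) else 0)"
        unfolding step_cost_def by (rule sum.cong) auto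
      also have "\<dots> = card (insert e (M a) - M a)" using a by simp
      also have "\<dots> \<le> card {e}" by (rule card_mono) auto
      also have "\<dots> \<le> n" using e by (auto simp: edges_def)
      finally show ?thesis .
    qed
    ultimately show ?thesis unfolding colours_def by blast
  next
    case False
    have free: "\<forall>f\<in>M a. fst f \<noteq> fst e" "\<forall>f\<in>M b. snd f \<noteq> snd e"
      using a(2) b(2) by (auto simp: disjoint_iff)
    have "e \<notin> M a \<union> M b" using a(1) b(1) e UF by blast
    from two_colour_insert[OF mat[OF a(1)] mat[OF b(1)] dis[OF a(1) b(1) False] e(1) this free]
    obtain A' B' where AB: "matching n A'" "matching n B'" "A' \<inter> B' = {}"
      "A' \<union> B' = insert e (M a \<union> M b)" "card (A' - M a) + card (B' - M b) \<le> n"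
      by blast
    let ?M = "M(a := A', b := B')"
    have "valid_cache n k ?M"
      using mat emp a(1) b(1) AB by (auto simp: valid_cache_def)
    moreover have "cached k ?M = insert e F"
    proof -
      have split: "{..<k} = insert a (insert b ({..<k} - {a, b}))" using a b by auto
      have "cached k ?M = A' \<union> B' \<union> (\<Union>c\<in>{..<k} - {a, b}. M c)"
        unfolding cached_def using False by (subst split) auto
      also have "\<dots> = insert e (M a \<union> M b \<union> (\<Union>c\<in>{..<k} - {a, b}. M c))" using AB(4) by auto
      also have "M a \<union> M b \<union> (\<Union>c\<in>{..<k} - {a, b}. M c) = (\<Union>c<k. M c)"
        by (subst (2) split) auto
      finally show ?thesis by (simp only: UF)
    qed
    moreover have "?M c \<inter> ?M d = {}" if "c < k" "d < k" "c \<noteq> d" for c d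
    proof -
      have out: "M c \<inter> A' = {}" "M c \<inter> B' = {}" if "c < k" "c \<noteq> a" "c \<noteq> b" for c
      proof -
        have "e \<notin> M c" using e UF that(1) by blast
        then have "M c \<inter> (A' \<union> B') = {}"
          unfolding AB(4) using dis[OF that(1) a(1) that(2)] dis[OF that(1) b(1) that(3)]
          by (simp add: Int_Un_distrib)
        then show "M c \<inter> A' = {}" "M c \<inter> B' = {}" by blast+
      qed
      consider "c \<in> {a, b}" "d \<in> {a, b}" | "c \<notin> {a, b}" "d \<notin> {a, b}"
        | "c \<in> {a, b}" "d \<notin> {a, b}" | "c \<notin> {a, b}" "d \<in> {a, b}" by blast
      then show ?thesis
      proof cases
        case 1
        then show ?thesis using AB(3) that(3) by auto
      next
        case 2
        then show ?thesis using dis[OF that] by simp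
      next
        case 3
        then show ?thesis using out[OF that(2)] by (auto simp: Int_commute)
      next
        case 4
        then show ?thesis using out[OF that(1)] by auto
      qed
    qed
    moreover have "step_cost k M ?M \<le> n"
    proof -
      have "step_cost k M ?M = (\<Sum>c<k. (if c = a then card (A' - M a) else 0) +
          (if c = b then card (B' - M b) else 0))"
        unfolding step_cost_def by (rule sum.cong) (use False in auto)
      also have "\<dots> = card (A' - M a) + card (B' - M b)"
        using a b by (simp add: sum.distrib)
      finally show ?thesis using AB by simp
    qed
    ultimately show ?thesis unfolding colours_def by blast
  qed
qed

text \<open>A hit needs only evictions, which are free. A miss first evicts everything outside
  \<open>F'\<close>, leaving room at both endpoints of \<open>e\<close>, and then inserts
  \<open>e\<close>.\<close>

lemma colours_step:
  assumes M: "colours n k M F" and F': "F' \<subseteq> edges n" "e \<in> F'" "F' \<subseteq> insert e F"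
    and deg: "\<And>w. card (F' \<inter> star w) \<le> k"
  shows "\<exists>M'. colours n k M' F' \<and> step_cost k M M' \<le> (if e \<in> F then 0 else n)"
proof (cases "e \<in> F")
  case True
  have "colours n k (\<lambda>c. M c \<inter> F') F'"
    using colours_restrict[OF M, of F'] F' True by (simp add: Int_absorb1 insert_absorb)
  moreover have "step_cost k M (\<lambda>c. M c \<inter> F') = 0"
    unfolding step_cost_def by (simp add: Diff_eq_empty_iff[THEN iffD2])
  ultimately show ?thesis using True by (metis le_refl)
next
  case False
  let ?M = "\<lambda>c. M c \<inter> (F' - {e})"
  have "F \<inter> (F' - {e}) = F' - {e}" using F' by blast
  then have M0: "colours n k ?M (F' - {e})"
    using colours_restrict[OF M, of "F' - {e}"] by simp
  have finF': "finite F'" using F' finite_edges finite_subset by blast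
  have "card ((F' - {e}) \<inter> star w) < k" if "e \<in> star w" for w
  proof -
    have "card ((F' - {e}) \<inter> star w) < card (F' \<inter> star w)"
      by (rule psubset_card_mono) (use finF' F' that in auto)
    then show ?thesis using deg[of w] by linarith
  qed
  then obtain M' where M': "colours n k M' (insert e (F' - {e}))" "step_cost k ?M M' \<le> n"
    using colours_insert[OF M0] F' by blast
  \<comment> \<open>Relative to the larger cache \<open>M\<close> no more edges count as added, so
    the eviction and the insertion merge into one step.\<close>
  have "step_cost k M M' \<le> step_cost k ?M M'"
    unfolding step_cost_def
    by (intro sum_mono card_mono) (use colours_finite[OF M'(1)] in auto)
  then show ?thesis using M' False F' by (auto simp: insert_absorb intro!: exI[of _ M'])
qed

section \<open>From edge-set strategies to online algorithms\<close>

text \<open>The history is reversed, with the newest request at the head, so that primitive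
  recursion follows the order of time.\<close>

primrec realize :: "nat \<Rightarrow> nat \<Rightarrow> (edge list \<Rightarrow> edge set) \<Rightarrow> edge list \<Rightarrow> cache" where
  "realize n k F [] = (\<lambda>c. {})"
| "realize n k F (e # \<tau>) = (SOME M. colours n k M (F (rev (e # \<tau>))) \<and>
     step_cost k (realize n k F \<tau>) M \<le> (if e \<in> F (rev \<tau>) then 0 else n))"

definition lazy_strategy :: "nat \<Rightarrow> nat \<Rightarrow> (edge list \<Rightarrow> edge set) \<Rightarrow> bool" where
  "lazy_strategy n k F \<longleftrightarrow> F [] = {} \<and>
     (\<forall>\<sigma>\<in>lists (edges n). bounded_degree n k (F \<sigma>)) \<and>
     (\<forall>\<sigma>\<in>lists (edges n). \<forall>e\<in>edges n. e \<in> F (\<sigma> @ [e]) \<and> F (\<sigma> @ [e]) \<subseteq> insert e (F \<sigma>))"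

text \<open>The choice in \<open>realize\<close> is meaningful only if the previous cache colours
  the previous edge set, so both claims go through one induction.\<close>

lemma realize_colours:
  assumes F: "lazy_strategy n k F"
  shows "\<tau> \<in> lists (edges n) \<Longrightarrow> colours n k (realize n k F \<tau>) (F (rev \<tau>)) \<and>
    (\<tau> \<noteq> [] \<longrightarrow> step_cost k (realize n k F (tl \<tau>)) (realize n k F \<tau>)
       \<le> (if hd \<tau> \<in> F (rev (tl \<tau>)) then 0 else n))"
proof (induction \<tau>)
  case Nil
  then show ?case
    using F by (auto simp: lazy_strategy_def colours_def valid_cache_def matching_def cached_def)
next
  case (Cons e \<tau>)
  then have IH: "colours n k (realize n k F \<tau>) (F (rev \<tau>))" by auto
  have r: "rev \<tau> \<in> lists (edges n)" "rev (e # \<tau>) \<in> lists (edges n)" "e \<in> edges n"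
    using Cons.prems by auto
  have "\<exists>M. colours n k M (F (rev (e # \<tau>))) \<and>
      step_cost k (realize n k F \<tau>) M \<le> (if e \<in> F (rev \<tau>) then 0 else n)"
    by (rule colours_step[OF IH]) (use F r in \<open>auto simp: lazy_strategy_def bounded_degree_def\<close>)
  from someI_ex[OF this] show ?case by simp
qed

lemma lists_take: "xs \<in> lists A \<Longrightarrow> take i xs \<in> lists A"
  by (auto dest: in_set_takeD)

lemma lists_rev: "xs \<in> lists A \<Longrightarrow> rev xs \<in> lists A"
  by auto

text \<open>This reduces both competitive bounds to counting the misses of an uncoloured strategy;
  all recolouring is absorbed in the factor \<open>n\<close>.\<close>

lemma lazy_strategy_algorithm:
  assumes F: "lazy_strategy n k F"
  obtains A where "online_algorithm n k A"
    and "\<And>\<sigma>. \<sigma> \<in> lists (edges n) \<Longrightarrow>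
      alg_cost k A \<sigma> \<le> n * (\<Sum>i<length \<sigma>. if \<sigma> ! i \<in> F (take i \<sigma>) then 0 else 1)"
proof (rule that[of "\<lambda>\<sigma>. realize n k F (rev \<sigma>)"])
  let ?A = "\<lambda>\<sigma>. realize n k F (rev \<sigma>)"
  have col: "colours n k (?A (take i \<sigma>)) (F (take i \<sigma>))" if "\<sigma> \<in> lists (edges n)" for \<sigma> i
    using realize_colours[OF F lists_rev[OF lists_take[OF that]], THEN conjunct1] by (simp only: rev_rev_ident)
  show "online_algorithm n k ?A"
    unfolding online_algorithm_def serves_def run_def
  proof (intro ballI conjI allI impI)
    fix \<sigma> i assume \<sigma>: "\<sigma> \<in> lists (edges n)"
    show "?A (take 0 \<sigma>) = (\<lambda>c. {})" by simp
    show "valid_cache n k (?A (take i \<sigma>))" using col[OF \<sigma>] by (simp add: colours_def)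
    assume i: "i < length \<sigma>"
    have "\<sigma> ! i \<in> F (take i \<sigma> @ [\<sigma> ! i])"
      using F lists_take[OF \<sigma>, of i] \<sigma> i unfolding lazy_strategy_def by (meson in_listsD nth_mem)
    then show "\<sigma> ! i \<in> cached k (?A (take (Suc i) \<sigma>))"
      using col[OF \<sigma>, of "Suc i"] i by (simp add: colours_def take_Suc_conv_app_nth)
  qed
  fix \<sigma> assume \<sigma>: "\<sigma> \<in> lists (edges n)"
  have "alg_cost k ?A \<sigma> \<le> (\<Sum>i<length \<sigma>. if \<sigma> ! i \<in> F (take i \<sigma>) then 0 else n)"
    unfolding alg_cost_def schedule_cost_def run_def
  proof (rule sum_mono)
    fix i assume "i \<in> {..<length \<sigma>}"
    then have i: "i < length \<sigma>" by simp
    have "rev (take (Suc i) \<sigma>) \<in> lists (edges n)" by (intro lists_rev lists_take \<sigma>)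
    from realize_colours[OF F this, THEN conjunct2] i
    show "step_cost k (?A (take i \<sigma>)) (?A (take (Suc i) \<sigma>)) \<le> (if \<sigma> ! i \<in> F (take i \<sigma>) then 0 else n)"
      by (simp only: take_Suc_conv_app_nth rev_append rev.simps append.simps list.sel rev_rev_ident) simp
  qed
  also have "\<dots> = n * (\<Sum>i<length \<sigma>. if \<sigma> ! i \<in> F (take i \<sigma>) then 0 else 1)"
    by (simp add: sum_distrib_left if_distrib cong: if_cong)
  finally show "alg_cost k ?A \<sigma> \<le> n * (\<Sum>i<length \<sigma>. if \<sigma> ! i \<in> F (take i \<sigma>) then 0 else 1)" .
qed

section \<open>The optimum and the deterministic algorithm\<close>

lemma bounded_degree_finite: "bounded_degree n k F \<Longrightarrow> finite F"
  unfolding bounded_degree_def by (metis finite_edges finite_subset)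

lemma bounded_degree_subset:
  assumes "bounded_degree n k F" "G \<subseteq> F"
  shows "bounded_degree n k G"
proof -
  have "card (G \<inter> star w) \<le> card (F \<inter> star w)" for w
    by (rule card_mono) (use assms bounded_degree_finite in auto)
  then show ?thesis using assms unfolding bounded_degree_def by (meson le_trans subset_trans)
qed

lemma bounded_degree_cached:
  assumes "valid_cache n k M"
  shows "bounded_degree n k (cached k M)"
proof -
  have "card (cached k M \<inter> star w) \<le> k" for w
  proof -
    have "cached k M \<inter> star w = (\<Union>c<k. M c \<inter> star w)" by (auto simp: cached_def)
    also have "card \<dots> \<le> (\<Sum>c<k. card (M c \<inter> star w))" by (rule card_UN_le) simp
    also have "\<dots> \<le> (\<Sum>c<k. 1)"
      by (intro sum_mono card_matching_star) (use assms in \<open>auto simp: valid_cache_def\<close>)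
    finally show ?thesis by simp
  qed
  then show ?thesis
    using assms by (auto simp: bounded_degree_def valid_cache_def matching_def cached_def)
qed

text \<open>An edge that enters the union must be added to at least one colour class.\<close>

lemma card_cached_diff_le_step_cost:
  assumes "valid_cache n k M'"
  shows "card (cached k M' - cached k M) \<le> step_cost k M M'"
proof -
  have fin: "finite (M' c)" if "c < k" for c
    using assms that by (auto simp: valid_cache_def intro: matching_finite)
  have "card (cached k M' - cached k M) \<le> card (\<Union>c<k. M' c - M c)"
    by (rule card_mono) (use fin in \<open>auto simp: cached_def\<close>)
  also have "\<dots> \<le> step_cost k M M'"
    unfolding step_cost_def by (rule card_UN_le) simp
  finally show ?thesis .
qed

text \<open>The run of \<open>A\<close> shows that some schedule exists, so the minimum in
  \<open>opt_cost\<close> is attained. Forgetting the colours of an optimal schedule leaves only its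
  insertions to compare with.\<close>

lemma optimal_edge_sets:
  assumes A: "online_algorithm n k A" and \<sigma>: "\<sigma> \<in> lists (edges n)"
  obtains Q :: "nat \<Rightarrow> edge set" where "Q 0 = {}"
    and "\<forall>i\<le>length \<sigma>. bounded_degree n k (Q i)"
    and "\<forall>i<length \<sigma>. \<sigma> ! i \<in> Q (Suc i)"
    and "(\<Sum>i<length \<sigma>. card (Q (Suc i) - Q i)) \<le> opt_cost n k \<sigma>"
proof -
  have "\<exists>x s. serves n k \<sigma> s \<and> schedule_cost k \<sigma> s = x"
    using A \<sigma> by (auto simp: online_algorithm_def)
  then have "\<exists>s. serves n k \<sigma> s \<and> schedule_cost k \<sigma> s = opt_cost n k \<sigma>"
    unfolding opt_cost_def by (rule LeastI_ex)
  then obtain s where s: "serves n k \<sigma> s" "schedule_cost k \<sigma> s = opt_cost n k \<sigma>" by blast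
  show ?thesis
  proof (rule that[of "\<lambda>i. cached k (s i)"])
    show "cached k (s 0) = {}" using s by (simp add: serves_def cached_def)
    show "\<forall>i\<le>length \<sigma>. bounded_degree n k (cached k (s i))"
      using s by (auto simp: serves_def intro: bounded_degree_cached)
    show "\<forall>i<length \<sigma>. \<sigma> ! i \<in> cached k (s (Suc i))"
      using s by (simp add: serves_def)
    have "(\<Sum>i<length \<sigma>. card (cached k (s (Suc i)) - cached k (s i))) \<le> schedule_cost k \<sigma> s"
      unfolding schedule_cost_def
      by (intro sum_mono card_cached_diff_le_step_cost[of n]) (use s in \<open>auto simp: serves_def\<close>)
    then show "(\<Sum>i<length \<sigma>. card (cached k (s (Suc i)) - cached k (s i))) \<le> opt_cost n k \<sigma>"
      using s by simp
  qed
qed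

section \<open>The flushing strategy\<close>

definition flush :: "nat \<Rightarrow> nat + nat \<Rightarrow> edge set \<Rightarrow> edge set" where
  "flush k w F = (if card (F \<inter> star w) < k then F else F - star w)"

definition flush_step :: "nat \<Rightarrow> edge \<Rightarrow> edge set \<Rightarrow> edge set" where
  "flush_step k e F = (if e \<in> F then F
     else insert e (flush k (Inr (snd e)) (flush k (Inl (fst e)) F)))"

definition flush_set :: "nat \<Rightarrow> edge list \<Rightarrow> edge set" where
  "flush_set k \<sigma> = foldl (\<lambda>F e. flush_step k e F) {} \<sigma>"

lemma flush_set_simps [simp]:
  "flush_set k [] = {}" "flush_set k (\<sigma> @ [e]) = flush_step k e (flush_set k \<sigma>)"
  by (simp_all add: flush_set_def)

lemma card_flush_star: "1 \<le> k \<Longrightarrow> card (flush k w F \<inter> star w) < k"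
  by (auto simp: flush_def Int_Diff Diff_Int_distrib2)

lemma flush_step_subset: "flush_step k e F \<subseteq> insert e F"
  by (auto simp: flush_step_def flush_def)

lemma bounded_degree_flush_step:
  assumes F: "bounded_degree n k F" and k: "1 \<le> k" and e: "e \<in> edges n"
  shows "bounded_degree n k (flush_step k e F)"
proof (cases "e \<in> F")
  case False
  define F1 where "F1 = flush k (Inl (fst e)) F"
  define F2 where "F2 = flush k (Inr (snd e)) F1"
  have sub: "F2 \<subseteq> F1" "F1 \<subseteq> F" by (auto simp: F1_def F2_def flush_def)
  have bd: "bounded_degree n k F2" using bounded_degree_subset[OF F] sub by blast
  have fin: "finite F1" "finite F2"
    using finite_subset[OF sub(1)] finite_subset[OF sub(2)] bounded_degree_finite[OF F] by simp_all
  have "card (insert e F2 \<inter> star w) \<le> k" for w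
  proof (cases "e \<in> star w")
    case True
    have "card (F2 \<inter> star w) < k"
    proof (cases w)
      case (Inl u)
      have "card (F2 \<inter> star w) \<le> card (F1 \<inter> star w)"
        by (rule card_mono) (use fin sub in auto)
      then show ?thesis using card_flush_star[OF k, of w F] True Inl by (simp add: F1_def)
    next
      case (Inr v)
      then show ?thesis using card_flush_star[OF k, of w F1] True by (simp add: F2_def)
    qed
    then show ?thesis using fin True by (simp add: card_insert_if)
  next
    case False
    then show ?thesis using bd by (simp add: bounded_degree_def)
  qed
  then show ?thesis
    using False bd e unfolding flush_step_def F1_def[symmetric] F2_def[symmetric]
    by (simp add: bounded_degree_def)
qed (use F in \<open>simp add: flush_step_def\<close>)

lemma bounded_degree_flush_set:
  assumes "1 \<le> k" "\<sigma> \<in> lists (edges n)"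
  shows "bounded_degree n k (flush_set k \<sigma>)"
  using assms(2)
proof (induction \<sigma> rule: rev_induct)
  case Nil
  then show ?case by (simp add: bounded_degree_def)
next
  case (snoc e \<sigma>)
  then show ?case using bounded_degree_flush_step assms(1) by auto
qed

lemma lazy_strategy_flush:
  assumes "1 \<le> k"
  shows "lazy_strategy n k (flush_set k)"
  unfolding lazy_strategy_def
proof (intro conjI ballI allI)
  fix \<sigma> e assume \<sigma>: "\<sigma> \<in> lists (edges n)"
  show "e \<in> flush_set k (\<sigma> @ [e])" by (simp add: flush_step_def)
  show "flush_set k (\<sigma> @ [e]) \<subseteq> insert e (flush_set k \<sigma>)" by (simp add: flush_step_subset)
  show "bounded_degree n k (flush_set k \<sigma>)" by (rule bounded_degree_flush_set[OF assms \<sigma>])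
qed simp

definition flush_potential :: "nat \<Rightarrow> edge set \<Rightarrow> edge set \<Rightarrow> real" where
  "flush_potential k Q F = (real k - 1) * card F + real k * card (Q - F)"

lemma flush_potential_nonneg: "1 \<le> k \<Longrightarrow> 0 \<le> flush_potential k Q F"
  by (simp add: flush_potential_def)

text \<open>A flush removes \<open>k\<close> edges from \<open>F\<close>, lowering the first term by
  \<open>k * (k - 1)\<close>. At most \<open>k - 1\<close> of them lie in \<open>Q\<close>, since
  \<open>Q\<close> has at most \<open>k\<close> edges at \<open>w\<close> and one of these is
  \<open>e\<close>, absent from \<open>F\<close>. Hence the second term rises by no more.\<close>

lemma flush_potential_flush:
  assumes Q: "bounded_degree n k Q" and F: "bounded_degree n k F" and e: "e \<in> Q" "e \<notin> F" "e \<in> star w"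
  shows "flush_potential k Q (flush k w F) \<le> flush_potential k Q F"
proof (cases "card (F \<inter> star w) < k")
  case False
  note fin = bounded_degree_finite[OF Q] bounded_degree_finite[OF F]
  have full: "card (F \<inter> star w) = k" using F False by (auto simp: bounded_degree_def le_antisym)
  have "card (F - star w) + card (F \<inter> star w) = card F"
    using fin by (metis add.commute card_Int_Diff)
  then have 1: "real (card F) = card (F - star w) + k" using full by linarith
  have "card (Q \<inter> F \<inter> star w) < card (Q \<inter> star w)"
    by (rule psubset_card_mono) (use fin e in auto)
  also have "\<dots> \<le> k" using Q by (auto simp: bounded_degree_def)
  finally have lt: "real (card (Q \<inter> F \<inter> star w)) \<le> real k - 1" by linarith
  have "Q - (F - star w) \<subseteq> (Q - F) \<union> (Q \<inter> F \<inter> star w)" by auto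
  then have "card (Q - (F - star w)) \<le> card ((Q - F) \<union> (Q \<inter> F \<inter> star w))"
    by (rule card_mono[rotated]) (use fin in auto)
  also have "\<dots> \<le> card (Q - F) + card (Q \<inter> F \<inter> star w)" by (rule card_Un_le)
  finally have "real (card (Q - (F - star w))) \<le> card (Q - F) + (real k - 1)" using lt by linarith
  then have "real k * card (Q - (F - star w)) \<le> real k * (card (Q - F) + (real k - 1))"
    by (rule mult_left_mono) simp
  then show ?thesis using False 1 by (simp add: flush_potential_def flush_def algebra_simps)
qed (simp add: flush_def)

text \<open>After the flushes, inserting \<open>e\<close> raises the first term by
  \<open>k - 1\<close> and lowers the second by \<open>k\<close>; the difference of 1 pays for the
  miss.\<close>

lemma flush_potential_step:
  assumes Q: "bounded_degree n k Q" and F: "bounded_degree n k F" and e: "e \<in> Q"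
  shows "(if e \<in> F then 0 else 1) + flush_potential k Q (flush_step k e F) \<le> flush_potential k Q F"
proof (cases "e \<in> F")
  case False
  define F1 where "F1 = flush k (Inl (fst e)) F"
  define F2 where "F2 = flush k (Inr (snd e)) F1"
  have sub: "F2 \<subseteq> F1" "F1 \<subseteq> F" by (auto simp: F1_def F2_def flush_def)
  have bd: "bounded_degree n k F1" using bounded_degree_subset[OF F] sub by blast
  have fin: "finite Q" "finite F2"
    using finite_subset[OF sub(1)] bounded_degree_finite[OF bd] bounded_degree_finite[OF Q]
    by simp_all
  have e2: "e \<notin> F2" using False sub by blast
  have "Q - F2 = insert e (Q - insert e F2)" using e e2 by blast
  then have "card (Q - F2) = Suc (card (Q - insert e F2))"
    using fin(1) by (metis DiffD2 card_insert_disjoint finite_Diff insertI1)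
  then have "1 + flush_potential k Q (insert e F2) = flush_potential k Q F2"
    using fin e2 by (simp add: flush_potential_def algebra_simps)
  also have "\<dots> \<le> flush_potential k Q F1"
    unfolding F2_def by (rule flush_potential_flush[OF Q bd e]) (use False sub in auto)
  also have "\<dots> \<le> flush_potential k Q F"
    unfolding F1_def by (rule flush_potential_flush[OF Q F e]) (use False in auto)
  finally show ?thesis using False by (simp add: flush_step_def F1_def F2_def)
qed (simp add: flush_step_def)

lemma card_diff_triangle:
  assumes "finite A" "finite B"
  shows "card (B - C) \<le> card (A - C) + card (B - A)"
proof -
  have "card (B - C) \<le> card ((A - C) \<union> (B - A))"
    by (rule card_mono) (use assms in auto)
  also have "\<dots> \<le> card (A - C) + card (B - A)" by (rule card_Un_le)
  finally show ?thesis .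
qed

lemma flush_misses:
  assumes k: "1 \<le> k" and \<sigma>: "\<sigma> \<in> lists (edges n)" and Q0: "Q 0 = {}"
    and Q: "\<forall>i\<le>length \<sigma>. bounded_degree n k (Q i)"
    and req: "\<forall>i<length \<sigma>. \<sigma> ! i \<in> Q (Suc i)"
  shows "(\<Sum>i<length \<sigma>. if \<sigma> ! i \<in> flush_set k (take i \<sigma>) then 0 else 1)
    \<le> k * (\<Sum>i<length \<sigma>. card (Q (Suc i) - Q i))"
proof -
  let ?F = "\<lambda>i. flush_set k (take i \<sigma>)"
  have "(\<Sum>i<m. if \<sigma> ! i \<in> ?F i then 0 else 1) + flush_potential k (Q m) (?F m)
      \<le> real k * (\<Sum>i<m. card (Q (Suc i) - Q i))" if "m \<le> length \<sigma>" for m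
    using that
  proof (induction m)
    case 0
    show ?case by (simp add: Q0 flush_potential_def)
  next
    case (Suc m)
    then have m: "m < length \<sigma>" by simp
    have bd: "bounded_degree n k (?F m)"
      by (rule bounded_degree_flush_set[OF k]) (use \<sigma> in \<open>auto dest: in_set_takeD\<close>)
    have F: "?F (Suc m) = flush_step k (\<sigma> ! m) (?F m)"
      using m by (simp add: take_Suc_conv_app_nth)
    \<comment> \<open>The optimum moves first: each edge it inserts raises the potential by at most
      \<open>k\<close>, and its evictions never raise it.\<close>
    have "real (card (Q (Suc m) - ?F m)) \<le> card (Q m - ?F m) + card (Q (Suc m) - Q m)"
      using card_diff_triangle[of "Q m" "Q (Suc m)" "?F m"] Q m bounded_degree_finite
      by (metis Suc_leI less_imp_le of_nat_add of_nat_le_iff)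
    then have "real k * card (Q (Suc m) - ?F m) \<le> real k * (card (Q m - ?F m) + card (Q (Suc m) - Q m))"
      by (rule mult_left_mono) simp
    then have "flush_potential k (Q (Suc m)) (?F m)
        \<le> flush_potential k (Q m) (?F m) + real k * card (Q (Suc m) - Q m)"
      by (simp add: flush_potential_def algebra_simps)
    then show ?case
      using flush_potential_step[OF Q[rule_format, of "Suc m"] bd req[rule_format, OF m]] m Suc
      by (simp add: F algebra_simps)
  qed
  from this[OF order_refl] have "(\<Sum>i<length \<sigma>. if \<sigma> ! i \<in> ?F i then 0 else 1)
      \<le> real k * (\<Sum>i<length \<sigma>. card (Q (Suc i) - Q i))"
    using flush_potential_nonneg[OF k, of "Q (length \<sigma>)" "?F (length \<sigma>)"] by linarith
  then have "real (\<Sum>i<length \<sigma>. if \<sigma> ! i \<in> ?F i then 0 else 1)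
      \<le> real (k * (\<Sum>i<length \<sigma>. card (Q (Suc i) - Q i)))"
    by (simp add: if_distrib cong: if_cong)
  then show ?thesis by (simp only: of_nat_le_iff)
qed

lemma deterministic_competitive:
  assumes k: "1 \<le> k"
  shows "\<exists>A. online_algorithm n k A \<and> competitive n k A (real (n * k))"
proof -
  obtain A where A: "online_algorithm n k A"
    "\<And>\<sigma>. \<sigma> \<in> lists (edges n) \<Longrightarrow>
      alg_cost k A \<sigma> \<le> n * (\<Sum>i<length \<sigma>. if \<sigma> ! i \<in> flush_set k (take i \<sigma>) then 0 else 1)"
    using lazy_strategy_algorithm[OF lazy_strategy_flush[OF k]] by blast
  have "alg_cost k A \<sigma> \<le> n * k * opt_cost n k \<sigma>" if \<sigma>: "\<sigma> \<in> lists (edges n)" for \<sigma>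
  proof -
    obtain Q where Q: "Q 0 = {}" "\<forall>i\<le>length \<sigma>. bounded_degree n k (Q i)"
      "\<forall>i<length \<sigma>. \<sigma> ! i \<in> Q (Suc i)"
      "(\<Sum>i<length \<sigma>. card (Q (Suc i) - Q i)) \<le> opt_cost n k \<sigma>"
      using optimal_edge_sets[OF A(1) \<sigma>] by blast
    have "alg_cost k A \<sigma> \<le> n * (k * (\<Sum>i<length \<sigma>. card (Q (Suc i) - Q i)))"
      using A(2)[OF \<sigma>] flush_misses[OF k \<sigma> Q(1-3)] by (meson le_trans mult_le_mono2)
    also have "\<dots> \<le> n * (k * opt_cost n k \<sigma>)" using Q(4) by (intro mult_le_mono2)
    finally show ?thesis by (simp add: mult.assoc)
  qed
  then have "real (alg_cost k A \<sigma>) \<le> real (n * k) * real (opt_cost n k \<sigma>) + 0"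
    if "\<sigma> \<in> lists (edges n)" for \<sigma>
    using that by (metis add.right_neutral of_nat_le_iff of_nat_mult)
  then show ?thesis using A(1) unfolding competitive_def by blast
qed

section \<open>The randomized algorithm\<close>

definition rank :: "('a \<Rightarrow> 'b::linorder) \<Rightarrow> 'a set \<Rightarrow> 'a \<Rightarrow> nat" where
  "rank f S x = card {y \<in> S. f y < f x}"

text \<open>Ranks are strictly monotone in \<open>f\<close>, hence distinct. Being
  \<open>card S\<close> numbers below \<open>card S\<close>, they exhaust all of them.\<close>

lemma rank_image:
  assumes S: "finite S" and f: "inj_on f S"
  shows "inj_on (rank f S) S" and "rank f S ` S = {..<card S}"
proof -
  have less: "rank f S x < rank f S y" if "x \<in> S" "y \<in> S" "f x < f y" for x y
    unfolding rank_def by (rule psubset_card_mono) (use S that in auto)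
  show inj: "inj_on (rank f S) S"
  proof (rule inj_onI, rule ccontr)
    fix x y assume xy: "x \<in> S" "y \<in> S" "rank f S x = rank f S y" "x \<noteq> y"
    then have "f x \<noteq> f y" using f by (auto dest: inj_onD)
    then show False using less[of x y] less[of y x] xy by (auto simp: neq_iff)
  qed
  have "rank f S ` S \<subseteq> {..<card S}"
    unfolding rank_def using S by (auto intro!: psubset_card_mono)
  moreover have "card (rank f S ` S) = card {..<card S}" using inj by (simp add: card_image)
  ultimately show "rank f S ` S = {..<card S}" by (intro card_subset_eq) auto
qed

lemma card_rank_less:
  assumes "finite S" "inj_on f S"
  shows "card {x \<in> S. rank f S x < j} \<le> j"
proof -
  have "card {x \<in> S. rank f S x < j} = card (rank f S ` {x \<in> S. rank f S x < j})"
    by (rule card_image[symmetric]) (use rank_image(1)[OF assms] in \<open>auto intro: inj_on_subset\<close>)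
  also have "\<dots> \<le> card {..<j}" by (rule card_mono) auto
  finally show ?thesis by simp
qed

lemma card_rank_ge:
  assumes "finite S" "inj_on f S"
  shows "card {x \<in> S. j \<le> rank f S x} = card S - j"
proof -
  have "card {x \<in> S. j \<le> rank f S x} = card (rank f S ` {x \<in> S. j \<le> rank f S x})"
    by (rule card_image[symmetric]) (use rank_image(1)[OF assms] in \<open>auto intro: inj_on_subset\<close>)
  also have "rank f S ` {x \<in> S. j \<le> rank f S x} = {r \<in> rank f S ` S. j \<le> r}" by auto
  also have "\<dots> = {j..<card S}" using rank_image(2)[OF assms] by auto
  finally show ?thesis by simp
qed

text \<open>By symmetry the count is the same for all elements of \<open>S\<close>, and each permutation contributes
  exactly \<open>card S - j\<close> elements.\<close>

lemma card_permutations_rank_ge: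
  fixes f :: "'a \<Rightarrow> 'b::linorder"
  assumes E: "finite E" and S: "S \<subseteq> E" and f: "inj_on f E" and p: "p \<in> S"
  shows "card {\<pi>. \<pi> permutes E \<and> j \<le> rank (f \<circ> \<pi>) S p} * card S
    = card {\<pi>. \<pi> permutes E} * (card S - j)"
proof -
  let ?P = "{\<pi>. \<pi> permutes E}"
  let ?N = "\<lambda>x. {\<pi>. \<pi> permutes E \<and> j \<le> rank (f \<circ> \<pi>) S x}"
  have finP: "finite ?P" using E by (rule finite_permutations)
  have finS: "finite S" using E S finite_subset by metis
  have sym: "card (?N x) = card (?N p)" if x: "x \<in> S" for x
  proof -
    \<comment> \<open>Precomposition with this transposition turns the rank of \<open>x\<close> into
      that of \<open>p\<close>, and it is an involution on the permutations of
      \<open>E\<close>.\<close>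
    let ?t = "Transposition.transpose x p"
    have t: "?t permutes E" using x p S by (intro permutes_swap_id) auto
    have tS: "?t y \<in> S \<longleftrightarrow> y \<in> S" for y using x p by (auto simp: Transposition.transpose_def)
    have tt: "?t (?t y) = y" for y by simp
    have r: "rank (f \<circ> (\<pi> \<circ> ?t)) S p = rank (f \<circ> \<pi>) S x" for \<pi>
    proof -
      have "bij_betw ?t {y \<in> S. f (\<pi> (?t y)) < f (\<pi> x)} {y \<in> S. f (\<pi> y) < f (\<pi> x)}"
        by (rule bij_betw_byWitness[of _ ?t]) (auto simp: tS)
      then show ?thesis unfolding rank_def by (simp add: bij_betw_same_card)
    qed
    have r': "rank (f \<circ> (\<pi> \<circ> ?t)) S x = rank (f \<circ> \<pi>) S p" for \<pi>
      using r[of "\<pi> \<circ> ?t"] by (simp add: o_assoc[symmetric])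
    have cl: "\<pi> \<circ> ?t permutes E" if "\<pi> permutes E" for \<pi>
      using permutes_compose[OF t that] .
    have "bij_betw (\<lambda>\<pi>. \<pi> \<circ> ?t) (?N x) (?N p)"
      by (rule bij_betw_byWitness[of _ "\<lambda>\<pi>. \<pi> \<circ> ?t"]) (auto simp: r r' cl o_assoc[symmetric])
    then show ?thesis by (rule bij_betw_same_card)
  qed
  have "card (?N p) * card S = (\<Sum>x\<in>S. card (?N x))" using sym by (simp add: mult.commute)
  also have "\<dots> = (\<Sum>x\<in>S. \<Sum>\<pi>\<in>?P. if j \<le> rank (f \<circ> \<pi>) S x then 1 else 0)"
    using finP by (simp add: sum.If_cases Int_def)
  also have "\<dots> = (\<Sum>\<pi>\<in>?P. \<Sum>x\<in>S. if j \<le> rank (f \<circ> \<pi>) S x then 1 else 0)"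
    by (rule sum.swap)
  also have "\<dots> = (\<Sum>\<pi>\<in>?P. card S - j)"
  proof (rule sum.cong)
    fix \<pi> assume "\<pi> \<in> ?P"
    then have "\<pi> permutes E" by simp
    then have "inj_on (f \<circ> \<pi>) E"
      using f by (simp add: comp_inj_on permutes_inj_on permutes_image)
    then have "inj_on (f \<circ> \<pi>) S" using S inj_on_subset by blast
    from card_rank_ge[OF finS this, of j]
    show "(\<Sum>x\<in>S. if j \<le> rank (f \<circ> \<pi>) S x then 1 else 0) = card S - j"
      using finS by (simp add: sum.If_cases Int_def)
  qed simp
  finally show ?thesis by simp
qed

section \<open>The marking algorithm at each vertex\<close>

type_synonym marking = "edge set \<times> edge set"

text \<open>A state \<open>(K, S)\<close> records the set \<open>K\<close> of edges requested in the current phase, and those edges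
  of the previous phase that have not been requested again. The cached edges are those of \<open>K\<close> and
  the \<open>k - card K\<close> best ranked ones of \<open>S\<close>; the state itself does not depend on the ranking.\<close>

definition mark :: "nat \<Rightarrow> nat + nat \<Rightarrow> marking \<Rightarrow> edge \<Rightarrow> marking" where
  "mark k w x e = (case x of (K, S) \<Rightarrow>
     if e \<notin> star w \<or> e \<in> K then (K, S)
     else if card K < k then (insert e K, S - {e})
     else ({e}, K))"

definition marking_cache :: "nat \<Rightarrow> (edge \<Rightarrow> nat) \<Rightarrow> marking \<Rightarrow> edge set" where
  "marking_cache k f x = (case x of (K, S) \<Rightarrow> K \<union> {y \<in> S. rank f S y < k - card K})"

definition marking_inv :: "nat \<Rightarrow> nat \<Rightarrow> nat + nat \<Rightarrow> marking \<Rightarrow> bool" where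
  "marking_inv n k w x \<longleftrightarrow> (case x of (K, S) \<Rightarrow> K \<union> S \<subseteq> edges n \<inter> star w \<and> K \<inter> S = {} \<and>
     card K \<le> k \<and> card S \<le> k)"

definition marking_after :: "nat \<Rightarrow> nat + nat \<Rightarrow> edge list \<Rightarrow> marking" where
  "marking_after k w \<sigma> = foldl (mark k w) ({}, {}) \<sigma>"

lemma marking_after_simps [simp]:
  "marking_after k w [] = ({}, {})"
  "marking_after k w (\<sigma> @ [e]) = mark k w (marking_after k w \<sigma>) e"
  by (simp_all add: marking_after_def)

lemma marking_inv_finite: "marking_inv n k w (K, S) \<Longrightarrow> finite K \<and> finite S"
  unfolding marking_inv_def by (auto intro: finite_subset[OF _ finite_edges])

lemma marking_inv_mark:
  assumes "marking_inv n k w x" "1 \<le> k" "e \<in> edges n"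
  shows "marking_inv n k w (mark k w x e)"
proof -
  obtain K S where x: "x = (K, S)" by (cases x)
  have fin: "finite K" "finite S" using marking_inv_finite assms x by auto
  have "card (S - {e}) \<le> k"
    using assms x card_Diff1_le[of S e] by (simp add: marking_inv_def)
  then show ?thesis
    using assms fin x by (auto simp: marking_inv_def mark_def card_insert_if)
qed

lemma marking_inv_after:
  assumes "1 \<le> k" "\<sigma> \<in> lists (edges n)"
  shows "marking_inv n k w (marking_after k w \<sigma>)"
  using assms(2)
proof (induction \<sigma> rule: rev_induct)
  case Nil
  then show ?case by (simp add: marking_inv_def)
next
  case (snoc e \<sigma>)
  then show ?case using marking_inv_mark assms(1) by auto
qed

lemma marking_cache_mark_mem: "e \<in> star w \<Longrightarrow> e \<in> marking_cache k f (mark k w x e)"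
  by (auto simp: marking_cache_def mark_def split: prod.split)

text \<open>At a phase change the new stale set is the old \<open>K\<close>, which was entirely
  cached. Within a phase the number of stale edges kept shrinks by one with each newly marked
  edge.\<close>

lemma marking_cache_mark_subset:
  assumes inv: "marking_inv n k w x" and f: "inj_on f (edges n)"
  shows "marking_cache k f (mark k w x e) \<subseteq> insert e (marking_cache k f x)"
proof -
  obtain K S where x: "x = (K, S)" by (cases x)
  have fin: "finite K" "finite S" using marking_inv_finite inv x by auto
  consider "e \<notin> star w \<or> e \<in> K" | "e \<in> star w" "e \<notin> K" "card K < k" | "e \<in> star w" "e \<notin> K" "\<not> card K < k"
    by blast
  then show ?thesis
  proof cases
    case 1
    then show ?thesis by (auto simp: mark_def x)
  next
    case 2
    \<comment> \<open>Removing \<open>e\<close> from \<open>S\<close> lowers a rank by at most one,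
      and the threshold drops by one as well, so no evicted stale edge returns.\<close>
    have "y \<in> insert e (marking_cache k f x)"
      if y: "y \<in> S" "y \<noteq> e" "rank f (S - {e}) y < k - Suc (card K)" for y
    proof -
      have "{z \<in> S. f z < f y} \<subseteq> insert e {z \<in> S - {e}. f z < f y}" by auto
      then have "rank f S y \<le> card (insert e {z \<in> S - {e}. f z < f y})"
        unfolding rank_def by (rule card_mono[rotated]) (use fin in auto)
      also have "\<dots> \<le> Suc (rank f (S - {e}) y)"
        using fin by (simp add: rank_def card_insert_if)
      finally have "rank f S y < k - card K" using y(3) by linarith
      then show ?thesis using y by (simp add: marking_cache_def x)
    qed
    moreover have "mark k w x e = (insert e K, S - {e})" using 2 by (simp add: mark_def x)
    ultimately show ?thesis
      using 2 fin by (auto simp: marking_cache_def x)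
  next
    case 3
    then show ?thesis by (auto simp: mark_def x marking_cache_def)
  qed
qed

lemma card_marking_cache:
  assumes inv: "marking_inv n k w x" and f: "inj_on f (edges n)"
  shows "card (marking_cache k f x) \<le> k"
proof -
  obtain K S where x: "x = (K, S)" by (cases x)
  have fin: "finite K" "finite S" using marking_inv_finite inv x by auto
  have "inj_on f S" using inv x by (auto simp: marking_inv_def intro: inj_on_subset[OF f])
  then have "card {y \<in> S. rank f S y < k - card K} \<le> k - card K"
    by (rule card_rank_less[OF fin(2)])
  then have "card (K \<union> {y \<in> S. rank f S y < k - card K}) \<le> card K + (k - card K)"
    using card_Un_le[of K "{y \<in> S. rank f S y < k - card K}"] by linarith
  then show ?thesis using inv x by (simp add: marking_cache_def marking_inv_def)
qed

definition marking_set :: "nat \<Rightarrow> nat \<Rightarrow> (edge \<Rightarrow> nat) \<Rightarrow> edge list \<Rightarrow> edge set" where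
  "marking_set n k f \<sigma> = {e \<in> edges n. \<forall>w. e \<in> star w \<longrightarrow> e \<in> marking_cache k f (marking_after k w \<sigma>)}"

text \<open>Requiring consent of both endpoints keeps each degree below the size of that vertex's
  own cache. At both endpoints of the request the requested edge is wanted, and at any vertex it is
  the only possible newcomer.\<close>

lemma lazy_strategy_marking:
  assumes k: "1 \<le> k" and f: "inj_on f (edges n)"
  shows "lazy_strategy n k (marking_set n k f)"
  unfolding lazy_strategy_def bounded_degree_def
proof (intro conjI ballI allI)
  have "e \<in> star (Inl (fst e))" for e :: edge by simp
  then show "marking_set n k f [] = {}"
    unfolding marking_set_def by (fastforce simp: marking_cache_def)
next
  fix \<sigma> w assume \<sigma>: "\<sigma> \<in> lists (edges n)"
  show "marking_set n k f \<sigma> \<subseteq> edges n" by (auto simp: marking_set_def)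
  let ?C = "marking_cache k f (marking_after k w \<sigma>)"
  note inv = marking_inv_after[OF k \<sigma>, of w]
  have "finite ?C" using inv
    by (cases "marking_after k w \<sigma>") (auto simp: marking_cache_def dest: marking_inv_finite)
  then have "card (marking_set n k f \<sigma> \<inter> star w) \<le> card ?C"
    by (rule card_mono) (auto simp: marking_set_def)
  then show "card (marking_set n k f \<sigma> \<inter> star w) \<le> k"
    using card_marking_cache[OF inv f] by linarith
next
  fix \<sigma> e assume \<sigma>: "\<sigma> \<in> lists (edges n)" and e: "e \<in> edges n"
  show "e \<in> marking_set n k f (\<sigma> @ [e])"
    using e by (auto simp: marking_set_def intro: marking_cache_mark_mem)
  show "marking_set n k f (\<sigma> @ [e]) \<subseteq> insert e (marking_set n k f \<sigma>)"
    unfolding marking_set_def marking_after_simps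
    using marking_cache_mark_subset[OF marking_inv_after[OF k \<sigma>] f, of _ e] by (blast dest: subsetD)
qed

section \<open>Expected misses by a harmonic potential\<close>

text \<open>The deficit is the number of edges of \<open>S\<close> that are not cached (truncated to \<open>0\<close> in the first
  phase, while the cache is not full); \<open>miss_prob\<close> refers to a uniformly random ranking.\<close>

definition deficit :: "nat \<Rightarrow> marking \<Rightarrow> nat" where
  "deficit k x = (case x of (K, S) \<Rightarrow> card S + card K - k)"

definition miss_prob :: "nat \<Rightarrow> nat + nat \<Rightarrow> marking \<Rightarrow> edge \<Rightarrow> real" where
  "miss_prob k w x e = (case x of (K, S) \<Rightarrow>
     if e \<notin> star w \<or> e \<in> K then 0 else if e \<in> S then deficit k x / card S else 1)"

text \<open>The state \<open>x\<close> is fixed while \<open>\<pi>\<close> varies, so a stale edge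
  has a uniform rank in \<open>S\<close>. Both sides are scaled by the number of permutations, which
  keeps the argument a finite count.\<close>

lemma miss_count:
  fixes g :: "edge \<Rightarrow> nat"
  assumes inv: "marking_inv n k w x" and g: "inj_on g (edges n)"
  shows "(\<Sum>\<pi> | \<pi> permutes edges n. if e \<in> star w \<and> e \<notin> marking_cache k (g \<circ> \<pi>) x then 1 else 0)
    \<le> card {\<pi>. \<pi> permutes edges n} * miss_prob k w x e"
proof -
  obtain K S where x: "x = (K, S)" by (cases x)
  have fin: "finite K" "finite S" using marking_inv_finite inv x by auto
  let ?P = "{\<pi>. \<pi> permutes edges n}"
  have finP: "finite ?P" by (simp add: finite_permutations)
  consider "e \<notin> star w \<or> e \<in> K" | "e \<in> star w" "e \<notin> K" "e \<in> S" | "e \<in> star w" "e \<notin> K" "e \<notin> S" by blast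
  then show ?thesis
  proof cases
    case 1
    then have "(\<Sum>\<pi>\<in>?P. if e \<in> star w \<and> e \<notin> marking_cache k (g \<circ> \<pi>) x then 1 else 0) = (0::real)"
      by (intro sum.neutral) (auto simp: marking_cache_def x)
    then show ?thesis using 1 by (simp add: miss_prob_def x)
  next
    case 2
    have S: "S \<subseteq> edges n" and K: "card K \<le> k" using inv x by (auto simp: marking_inv_def)
    have "(e \<in> star w \<and> e \<notin> marking_cache k (g \<circ> \<pi>) x) \<longleftrightarrow> k - card K \<le> rank (g \<circ> \<pi>) S e" for \<pi>
      using 2 by (auto simp: marking_cache_def x)
    then have "(\<Sum>\<pi>\<in>?P. if e \<in> star w \<and> e \<notin> marking_cache k (g \<circ> \<pi>) x then 1 else 0)
        = real (card {\<pi>. \<pi> permutes edges n \<and> k - card K \<le> rank (g \<circ> \<pi>) S e})"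
      using finP by (simp add: sum.If_cases Int_def)
    moreover have "real (card {\<pi>. \<pi> permutes edges n \<and> k - card K \<le> rank (g \<circ> \<pi>) S e}) * card S
        = card ?P * real (card S - (k - card K))"
      by (simp only: of_nat_mult[symmetric] card_permutations_rank_ge[OF finite_edges S g 2(3)])
    moreover have "card S > 0" using 2 fin by (auto simp: card_gt_0_iff)
    moreover have "card S - (k - card K) = deficit k x" using K by (simp add: deficit_def x)
    ultimately show ?thesis using 2 by (simp add: miss_prob_def x field_simps)
  next
    case 3
    have "(\<Sum>\<pi>\<in>?P. if e \<in> star w \<and> e \<notin> marking_cache k (g \<circ> \<pi>) x then 1 else 0) \<le> (\<Sum>\<pi>\<in>?P. 1::real)"
      by (rule sum_mono) auto
    then show ?thesis using 3 by (simp add: miss_prob_def x)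
  qed
qed

text \<open>The last summand pays for the misses on stale edges: while no new edge is requested, they
  cost \<open>deficit / card S\<close> each, with \<open>S\<close> shrinking. Every new edge adds at most \<open>1 + harm k\<close>, which
  is paid by the first summand: the optimum must acquire the new edges of a phase that it does
  not hold at its start, and at the end of a phase it has lost previously requested edges.\<close>

definition marking_potential :: "nat \<Rightarrow> edge set \<Rightarrow> marking \<Rightarrow> real" where
  "marking_potential k Q x = (case x of (K, S) \<Rightarrow>
     (1 + harm k) * (card (Q - (K \<union> S)) + card (Q \<union> K)) + deficit k x * harm (card S))"

lemma marking_potential_nonneg: "0 \<le> marking_potential k Q x"
  by (auto simp: marking_potential_def harm_nonneg split: prod.split)

lemma marking_potential_mark:
  assumes inv: "marking_inv n k w x" and k: "1 \<le> k" and Q: "finite Q" "card Q \<le> k"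
    and e: "e \<in> star w \<Longrightarrow> e \<in> Q"
  shows "miss_prob k w x e + marking_potential k Q (mark k w x e) \<le> marking_potential k Q x"
proof -
  obtain K S where x: "x = (K, S)" by (cases x)
  have fin: "finite K" "finite S" using marking_inv_finite inv x by auto
  have card: "card K \<le> k" "card S \<le> k" using inv x by (auto simp: marking_inv_def)
  let ?H = "harm k :: real"
  consider "e \<notin> star w \<or> e \<in> K" | "e \<in> star w" "e \<notin> K" "card K < k" "e \<in> S"
    | "e \<in> star w" "e \<notin> K" "card K < k" "e \<notin> S" | "e \<in> star w" "e \<notin> K" "\<not> card K < k"
    by blast
  then show ?thesis
  proof cases
    case 1
    then show ?thesis by (auto simp: mark_def miss_prob_def x)
  next
    case 2
    have m: "mark k w x e = (insert e K, S - {e})" using 2 by (simp add: mark_def x)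
    have un: "insert e K \<union> (S - {e}) = K \<union> S" "Q \<union> insert e K = Q \<union> K" using 2 e by auto
    have cS: "card S = Suc (card (S - {e}))" using 2 fin by (metis card_Suc_Diff1)
    have "deficit k (insert e K, S - {e}) = deficit k x"
      using 2 fin cS by (simp add: deficit_def x)
    then have "marking_potential k Q (mark k w x e) = (1 + ?H) * (card (Q - (K \<union> S)) + card (Q \<union> K))
        + deficit k x * harm (card (S - {e}))"
      unfolding m marking_potential_def prod.case un by simp
    \<comment> \<open>The deficit is unchanged while the harmonic number drops by
      \<open>1 / card S\<close>; the product of the two is exactly the miss probability.\<close>
    moreover have "harm (card S) = harm (card (S - {e})) + 1 / real (card S)"
      unfolding cS harm_Suc by (simp add: inverse_eq_divide)
    ultimately show ?thesis
      using 2 by (simp add: marking_potential_def miss_prob_def x algebra_simps)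
  next
    case 3
    have m: "mark k w x e = (insert e K, S)" using 3 by (simp add: mark_def x)
    have "Q - (K \<union> S) = insert e (Q - (insert e K \<union> S))" using 3 e by auto
    then have c1: "card (Q - (K \<union> S)) = Suc (card (Q - (insert e K \<union> S)))"
      using Q by (metis DiffD2 UnI1 card_insert_disjoint finite_Diff insertI1)
    have "Q \<union> insert e K = Q \<union> K" using 3 e by auto
    then have p: "marking_potential k Q (mark k w x e) = (1 + ?H) * (card (Q - (insert e K \<union> S)) + card (Q \<union> K))
        + deficit k (insert e K, S) * harm (card S)"
      unfolding m marking_potential_def prod.case by simp
    \<comment> \<open>A new edge releases \<open>1 + ?H\<close> from the first summand: 1 for the
      certain miss, \<open>?H\<close> for the deficit growing by at most one.\<close>
    have "deficit k (insert e K, S) \<le> Suc (deficit k x)"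
      using 3 fin by (simp add: deficit_def x)
    then have "deficit k (insert e K, S) * harm (card S) \<le> real (Suc (deficit k x)) * harm (card S)"
      by (intro mult_right_mono) (simp_all add: harm_nonneg)
    moreover have "harm (card S) \<le> ?H" using card by (intro harm_mono)
    ultimately show ?thesis
      using 3 unfolding p by (simp add: marking_potential_def miss_prob_def x c1 algebra_simps)
  next
    case 4
    then have K: "card K = k" using card by simp
    have m: "mark k w x e = ({e}, K)" using 4 by (simp add: mark_def x)
    have "miss_prob k w x e \<le> 1"
      using 4 fin K card_gt_0_iff[of S] by (auto simp: miss_prob_def x deficit_def)
    \<comment> \<open>At a phase change \<open>Q \<union> K\<close> exceeds \<open>K\<close> by the
      edges of \<open>Q - K\<close>, among them \<open>e\<close>, and \<open>card Q\<close> is at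
      most \<open>k = card K\<close>. The count thus falls by at least one, releasing
      \<open>1 + ?H\<close> for the miss and for the new deficit of 1 over \<open>k\<close> stale
      edges.\<close>
    moreover have "card (Q - ({e} \<union> K)) + card (Q \<union> {e}) + 1 \<le> card (Q - (K \<union> S)) + card (Q \<union> K)"
    proof -
      have "Q - K = insert e (Q - ({e} \<union> K))" using 4 e by auto
      then have "card (Q - K) = Suc (card (Q - ({e} \<union> K)))"
        using Q by (metis DiffD2 UnI1 card_insert_disjoint finite_Diff insertI1)
      moreover have "Q \<union> K = (Q - K) \<union> K" by blast
      then have "card (Q \<union> K) = card (Q - K) + k"
        using Q fin K by (metis card_Un_disjoint Diff_disjoint Int_commute finite_Diff)
      moreover have "Q \<union> {e} = Q" using 4 e by auto
      ultimately show ?thesis using Q by simp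
    qed
    then have "(1 + ?H) * (real (card (Q - ({e} \<union> K)) + card (Q \<union> {e})) + 1)
        \<le> (1 + ?H) * real (card (Q - (K \<union> S)) + card (Q \<union> K))"
      by (intro mult_left_mono) (simp_all add: harm_nonneg)
    moreover have "deficit k ({e}, K) = 1" using K by (simp add: deficit_def)
    moreover have "0 \<le> deficit k x * (harm (card S) :: real)" by (simp add: harm_nonneg)
    ultimately show ?thesis
      unfolding m by (simp add: marking_potential_def x K algebra_simps)
  qed
qed

text \<open>An edge inserted by the optimum can raise each of the two cardinalities by one, whence
  the factor 2.\<close>

lemma marking_potential_change:
  assumes "finite Q" "finite Q'" and inv: "marking_inv n k w x"
  shows "marking_potential k Q' x \<le> marking_potential k Q x + 2 * (1 + harm k) * card (Q' - Q)"
proof -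
  obtain K S where x: "x = (K, S)" by (cases x)
  have fin: "finite K" "finite S" using marking_inv_finite inv x by auto
  have "card (Q' - (K \<union> S)) \<le> card (Q - (K \<union> S)) + card (Q' - Q)"
    using card_diff_triangle assms by blast
  moreover have "card (Q' \<union> K) \<le> card (Q \<union> K) + card (Q' - Q)"
  proof -
    have "card (Q' \<union> K) \<le> card ((Q \<union> K) \<union> (Q' - Q))"
      by (rule card_mono) (use assms fin in auto)
    also have "\<dots> \<le> card (Q \<union> K) + card (Q' - Q)" by (rule card_Un_le)
    finally show ?thesis .
  qed
  ultimately have "real (card (Q' - (K \<union> S)) + card (Q' \<union> K))
      \<le> real (card (Q - (K \<union> S)) + card (Q \<union> K)) + 2 * card (Q' - Q)"
    by linarith
  then have "(1 + harm k) * real (card (Q' - (K \<union> S)) + card (Q' \<union> K))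
      \<le> (1 + harm k) * (real (card (Q - (K \<union> S)) + card (Q \<union> K)) + 2 * card (Q' - Q))"
    by (intro mult_left_mono) (simp_all add: harm_nonneg)
  then show ?thesis by (simp add: marking_potential_def x algebra_simps)
qed

lemma marking_misses:
  assumes k: "1 \<le> k" and \<sigma>: "\<sigma> \<in> lists (edges n)" and Q0: "Q 0 = {}"
    and Q: "\<forall>i\<le>length \<sigma>. bounded_degree n k (Q i)"
    and req: "\<forall>i<length \<sigma>. \<sigma> ! i \<in> Q (Suc i)"
  shows "(\<Sum>i<length \<sigma>. miss_prob k w (marking_after k w (take i \<sigma>)) (\<sigma> ! i))
    \<le> 2 * (1 + harm k) * (\<Sum>i<length \<sigma>. card ((Q (Suc i) - Q i) \<inter> star w))"
proof -
  let ?x = "\<lambda>i. marking_after k w (take i \<sigma>)" and ?Q = "\<lambda>i. Q i \<inter> star w"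
  have "(\<Sum>i<m. miss_prob k w (?x i) (\<sigma> ! i)) + marking_potential k (?Q m) (?x m)
      \<le> 2 * (1 + harm k) * (\<Sum>i<m. card ((Q (Suc i) - Q i) \<inter> star w))" if "m \<le> length \<sigma>" for m
    using that
  proof (induction m)
    case 0
    show ?case by (simp add: Q0 marking_potential_def deficit_def)
  next
    case (Suc m)
    then have m: "m < length \<sigma>" by simp
    have inv: "marking_inv n k w (?x m)"
      by (rule marking_inv_after[OF k]) (rule lists_take[OF \<sigma>])
    have x: "?x (Suc m) = mark k w (?x m) (\<sigma> ! m)"
      using m by (simp add: take_Suc_conv_app_nth)
    have bd: "bounded_degree n k (Q m)" "bounded_degree n k (Q (Suc m))" using Q m by auto
    then have fin: "finite (?Q m)" "finite (?Q (Suc m))" and deg: "card (?Q (Suc m)) \<le> k"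
      by (simp_all add: bounded_degree_finite) (simp add: bounded_degree_def)
    have "?Q (Suc m) - ?Q m = (Q (Suc m) - Q m) \<inter> star w" by blast
    then have "marking_potential k (?Q (Suc m)) (?x m) \<le> marking_potential k (?Q m) (?x m)
        + 2 * (1 + harm k) * card ((Q (Suc m) - Q m) \<inter> star w)"
      using marking_potential_change[OF fin inv] by simp
    moreover have "miss_prob k w (?x m) (\<sigma> ! m) + marking_potential k (?Q (Suc m)) (?x (Suc m))
        \<le> marking_potential k (?Q (Suc m)) (?x m)"
      unfolding x by (rule marking_potential_mark[OF inv k fin(2) deg]) (use req m in auto)
    ultimately show ?case
      using Suc.IH m by (simp add: algebra_simps)
  qed
  from this[OF order_refl] show ?thesis
    using marking_potential_nonneg[of k "?Q (length \<sigma>)" "?x (length \<sigma>)"] by linarith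
qed

section \<open>Summation over all vertices\<close>

definition vertices :: "nat \<Rightarrow> (nat + nat) set" where
  "vertices n = {..<n} <+> {..<n}"

lemma finite_vertices [simp]: "finite (vertices n)"
  by (simp add: vertices_def)

text \<open>On each side the stars are disjoint, so every edge is counted at most once per
  side.\<close>

lemma sum_card_star_le:
  assumes "finite X"
  shows "(\<Sum>w\<in>vertices n. card (X \<inter> star w)) \<le> 2 * card X"
proof -
  have "(\<Sum>u<n. card (X \<inter> star (h u))) \<le> card X"
    if h: "\<And>u v. u \<noteq> v \<Longrightarrow> star (h u) \<inter> star (h v) = {}" for h :: "nat \<Rightarrow> nat + nat"
  proof -
    have "(\<Sum>u<n. card (X \<inter> star (h u))) = card (\<Union>u<n. X \<inter> star (h u))"
      by (rule card_UN_disjoint[symmetric]) (use assms h in blast)+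
    also have "\<dots> \<le> card X" by (rule card_mono) (use assms in auto)
    finally show ?thesis .
  qed
  from this[of Inl] this[of Inr] show ?thesis
    by (simp add: vertices_def sum.Plus disjoint_iff)
qed

lemma harm_le_ln:
  assumes "1 \<le> k"
  shows "harm k \<le> 1 + ln (real k)"
  using assms
proof (induction k rule: dec_induct)
  case base
  then show ?case by (simp add: harm_def)
next
  case (step m)
  \<comment> \<open>The bound \<open>ln x \<le> x - 1\<close> at this ratio makes each harmonic
    summand at most a difference of logarithms, which telescopes.\<close>
  have "ln (real m / real (Suc m)) \<le> real m / real (Suc m) - 1"
    by (rule ln_le_minus_one) (use step in simp)
  then have "1 / real (Suc m) \<le> ln (real (Suc m)) - ln (real m)"
    using step by (simp add: ln_div field_simps)
  then show ?case using step by (simp add: harm_Suc inverse_eq_divide)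
qed

text \<open>A miss occurs at one of the two endpoints at least, so it is bounded by the sum over all
  vertices. The constant 4 is the 2 of the potential times the two endpoints of each inserted
  edge.\<close>

lemma expected_marking_misses:
  fixes g :: "edge \<Rightarrow> nat"
  assumes k: "1 \<le> k" and \<sigma>: "\<sigma> \<in> lists (edges n)" and Q0: "Q 0 = {}"
    and Q: "\<forall>i\<le>length \<sigma>. bounded_degree n k (Q i)"
    and req: "\<forall>i<length \<sigma>. \<sigma> ! i \<in> Q (Suc i)"
    and g: "inj_on g (edges n)"
  shows "(\<Sum>\<pi> | \<pi> permutes edges n. \<Sum>i<length \<sigma>.
      if \<sigma> ! i \<in> marking_set n k (g \<circ> \<pi>) (take i \<sigma>) then 0 else 1)
    \<le> card {\<pi>. \<pi> permutes edges n} *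
      (4 * (1 + harm k) * (\<Sum>i<length \<sigma>. card (Q (Suc i) - Q i)))"
proof -
  let ?P = "{\<pi>. \<pi> permutes edges n}" and ?V = "vertices n"
  let ?x = "\<lambda>w i. marking_after k w (take i \<sigma>)"
  let ?miss = "\<lambda>\<pi> w i. if \<sigma> ! i \<in> star w \<and> \<sigma> ! i \<notin> marking_cache k (g \<circ> \<pi>) (?x w i) then 1 else 0 :: real"
  have \<sigma>E: "\<sigma> ! i \<in> edges n" if "i < length \<sigma>" for i using \<sigma> that by (meson in_listsD nth_mem)
  have "(if \<sigma> ! i \<in> marking_set n k (g \<circ> \<pi>) (take i \<sigma>) then 0 else 1) \<le> (\<Sum>w\<in>?V. ?miss \<pi> w i)"
    if i: "i < length \<sigma>" for \<pi> i
  proof (cases "\<sigma> ! i \<in> marking_set n k (g \<circ> \<pi>) (take i \<sigma>)")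
    case False
    then obtain w where w: "\<sigma> ! i \<in> star w" "\<sigma> ! i \<notin> marking_cache k (g \<circ> \<pi>) (?x w i)"
      using \<sigma>E[OF i] by (auto simp: marking_set_def)
    have "w \<in> ?V" using w(1) \<sigma>E[OF i] by (auto simp: vertices_def mem_star_iff edges_def)
    then have "?miss \<pi> w i \<le> (\<Sum>w\<in>?V. ?miss \<pi> w i)"
      by (intro member_le_sum) auto
    then show ?thesis using w False by simp
  qed (simp add: sum_nonneg)
  then have "(\<Sum>\<pi>\<in>?P. \<Sum>i<length \<sigma>. if \<sigma> ! i \<in> marking_set n k (g \<circ> \<pi>) (take i \<sigma>) then 0 else 1)
      \<le> (\<Sum>\<pi>\<in>?P. \<Sum>i<length \<sigma>. \<Sum>w\<in>?V. ?miss \<pi> w i)"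
    by (intro sum_mono) simp
  also have "\<dots> = (\<Sum>\<pi>\<in>?P. \<Sum>w\<in>?V. \<Sum>i<length \<sigma>. ?miss \<pi> w i)"
    by (intro sum.cong refl sum.swap)
  also have "\<dots> = (\<Sum>w\<in>?V. \<Sum>\<pi>\<in>?P. \<Sum>i<length \<sigma>. ?miss \<pi> w i)"
    by (rule sum.swap)
  also have "\<dots> = (\<Sum>w\<in>?V. \<Sum>i<length \<sigma>. \<Sum>\<pi>\<in>?P. ?miss \<pi> w i)"
    by (intro sum.cong refl sum.swap)
  also have "\<dots> \<le> (\<Sum>w\<in>?V. \<Sum>i<length \<sigma>. card ?P * miss_prob k w (?x w i) (\<sigma> ! i))"
    by (intro sum_mono miss_count[OF marking_inv_after[OF k lists_take[OF \<sigma>]] g])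
  also have "\<dots> = card ?P * (\<Sum>w\<in>?V. \<Sum>i<length \<sigma>. miss_prob k w (?x w i) (\<sigma> ! i))"
    by (simp add: sum_distrib_left)
  also have "\<dots> \<le> card ?P * (\<Sum>w\<in>?V. 2 * (1 + harm k) * (\<Sum>i<length \<sigma>. card ((Q (Suc i) - Q i) \<inter> star w)))"
    by (intro mult_left_mono sum_mono marking_misses[OF k \<sigma> Q0 Q req]) simp
  also have "(\<Sum>w\<in>?V. 2 * (1 + harm k) * (\<Sum>i<length \<sigma>. card ((Q (Suc i) - Q i) \<inter> star w)))
      = 2 * (1 + harm k) * real (\<Sum>w\<in>?V. \<Sum>i<length \<sigma>. card ((Q (Suc i) - Q i) \<inter> star w))"
    by (simp add: sum_distrib_left)
  also have "(\<Sum>w\<in>?V. \<Sum>i<length \<sigma>. card ((Q (Suc i) - Q i) \<inter> star w))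
      = (\<Sum>i<length \<sigma>. \<Sum>w\<in>?V. card ((Q (Suc i) - Q i) \<inter> star w))"
    by (rule sum.swap)
  also have "2 * (1 + harm k) * real \<dots> \<le> 2 * (1 + harm k) * real (\<Sum>i<length \<sigma>. 2 * card (Q (Suc i) - Q i))"
    by (intro mult_left_mono of_nat_mono sum_mono sum_card_star_le finite_Diff bounded_degree_finite[of n k])
      (use Q in \<open>auto simp: harm_nonneg\<close>)
  also have "2 * (1 + harm k) * real (\<Sum>i<length \<sigma>. 2 * card (Q (Suc i) - Q i))
      = 4 * (1 + harm k) * real (\<Sum>i<length \<sigma>. card (Q (Suc i) - Q i))"
    by (simp add: sum_distrib_left[symmetric])
  finally show ?thesis by (simp add: mult_left_mono o_def)
qed

lemma randomized_algorithm_competitive: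
  assumes k: "1 \<le> k"
  shows "\<exists>R. randomized_algorithm n k R \<and>
    randomized_competitive n k R (12 * real n * max 1 (ln (real k)))"
proof -
  let ?P = "{\<pi>. \<pi> permutes edges n}"
  define g :: "edge \<Rightarrow> nat" where "g = prod_encode"
  have g: "inj_on g X" for X unfolding g_def by (rule inj_prod_encode)
  have gP: "inj_on (g \<circ> \<pi>) (edges n)" if "\<pi> \<in> ?P" for \<pi>
    using that by (intro comp_inj_on g) (simp add: permutes_inj_on)
  have "\<forall>\<pi>\<in>?P. \<exists>A. online_algorithm n k A \<and> (\<forall>\<sigma>\<in>lists (edges n). alg_cost k A \<sigma>
      \<le> n * (\<Sum>i<length \<sigma>. if \<sigma> ! i \<in> marking_set n k (g \<circ> \<pi>) (take i \<sigma>) then 0 else 1))"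
  proof
    fix \<pi> assume "\<pi> \<in> ?P"
    show "\<exists>A. online_algorithm n k A \<and> (\<forall>\<sigma>\<in>lists (edges n). alg_cost k A \<sigma>
      \<le> n * (\<Sum>i<length \<sigma>. if \<sigma> ! i \<in> marking_set n k (g \<circ> \<pi>) (take i \<sigma>) then 0 else 1))"
      by (rule lazy_strategy_algorithm[OF lazy_strategy_marking[OF k gP[OF \<open>\<pi> \<in> ?P\<close>]]]) blast
  qed
  from bchoice[OF this] obtain A where "\<forall>\<pi>\<in>?P. online_algorithm n k (A \<pi>) \<and>
      (\<forall>\<sigma>\<in>lists (edges n). alg_cost k (A \<pi>) \<sigma>
        \<le> n * (\<Sum>i<length \<sigma>. if \<sigma> ! i \<in> marking_set n k (g \<circ> \<pi>) (take i \<sigma>) then 0 else 1))" ..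
  then have A: "online_algorithm n k (A \<pi>)"
    "\<sigma> \<in> lists (edges n) \<Longrightarrow> alg_cost k (A \<pi>) \<sigma>
      \<le> n * (\<Sum>i<length \<sigma>. if \<sigma> ! i \<in> marking_set n k (g \<circ> \<pi>) (take i \<sigma>) then 0 else 1)"
    if "\<pi> \<in> ?P" for \<pi> \<sigma>
    using that by (simp_all only:)
  define U where "U = uniform_count_measure ?P"
  \<comment> \<open>The discrete space on the finite range of \<open>A\<close> makes every response
    map measurable.\<close>
  define R where "R = distr U (count_space (A ` ?P)) A"
  have finP: "finite ?P" "?P \<noteq> {}" using permutes_id[of "edges n"] by (simp add: finite_permutations, blast)
  interpret U: prob_space U unfolding U_def by (rule prob_space_uniform_count_measure[OF finP])
  have meas: "A \<in> measurable U (count_space (A ` ?P))"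
    by (auto simp: U_def measurable_def space_uniform_count_measure sets_uniform_count_measure)
  have "randomized_algorithm n k R"
    unfolding randomized_algorithm_def
  proof (intro conjI ballI)
    show "prob_space R" unfolding R_def by (rule U.prob_space_distr[OF meas])
    show "online_algorithm n k B" if "B \<in> space R" for B using that A(1) by (auto simp: R_def)
    show "(\<lambda>A. A \<sigma>) \<in> measurable R (count_space UNIV)" for \<sigma> :: "edge list"
      by (simp add: R_def)
  qed
  moreover have "(\<integral>B. real (alg_cost k B \<sigma>) \<partial>R) \<le> 12 * real n * max 1 (ln (real k)) * real (opt_cost n k \<sigma>) + 0"
    if \<sigma>: "\<sigma> \<in> lists (edges n)" for \<sigma>
  proof -
    obtain \<pi>0 where "\<pi>0 \<in> ?P" using finP by blast
    then obtain Q where Q: "Q 0 = {}" "\<forall>i\<le>length \<sigma>. bounded_degree n k (Q i)"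
      "\<forall>i<length \<sigma>. \<sigma> ! i \<in> Q (Suc i)"
      "(\<Sum>i<length \<sigma>. card (Q (Suc i) - Q i)) \<le> opt_cost n k \<sigma>"
      using optimal_edge_sets[OF A(1) \<sigma>] by blast
    let ?miss = "\<lambda>\<pi>. \<Sum>i<length \<sigma>. if \<sigma> ! i \<in> marking_set n k (g \<circ> \<pi>) (take i \<sigma>) then 0 else 1 :: nat"
    have "(\<integral>B. real (alg_cost k B \<sigma>) \<partial>R) = (\<integral>\<pi>. real (alg_cost k (A \<pi>) \<sigma>) \<partial>U)"
      unfolding R_def by (rule integral_distr[OF meas]) simp
    also have "\<dots> = (\<Sum>\<pi>\<in>?P. real (alg_cost k (A \<pi>) \<sigma>)) / card ?P"
      unfolding U_def uniform_count_measure_def using finP(1)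
      by (subst lebesgue_integral_point_measure_finite) (simp_all add: sum_divide_distrib)
    also have "\<dots> \<le> (\<Sum>\<pi>\<in>?P. real (n * ?miss \<pi>)) / card ?P"
      by (intro divide_right_mono sum_mono of_nat_mono A(2) \<sigma>) auto
    also have "\<dots> = n * ((\<Sum>\<pi>\<in>?P. real (?miss \<pi>)) / card ?P)"
      by (simp only: of_nat_mult sum_distrib_left[symmetric] times_divide_eq_right)
    also have "\<dots> \<le> n * (4 * (1 + harm k) * opt_cost n k \<sigma>)"
    proof (rule mult_left_mono)
      have "(\<Sum>\<pi>\<in>?P. real (?miss \<pi>)) = (\<Sum>\<pi>\<in>?P. \<Sum>i<length \<sigma>.
          if \<sigma> ! i \<in> marking_set n k (g \<circ> \<pi>) (take i \<sigma>) then 0 else 1)"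
        by (intro sum.cong refl) (simp add: of_nat_sum if_distrib cong: if_cong)
      also have "\<dots> \<le> card ?P * (4 * (1 + harm k) * (\<Sum>i<length \<sigma>. card (Q (Suc i) - Q i)))"
        by (rule expected_marking_misses[OF k \<sigma> Q(1-3) g])
      also have "\<dots> \<le> card ?P * (4 * (1 + harm k) * opt_cost n k \<sigma>)"
        by (intro mult_left_mono of_nat_mono Q(4)) (simp_all add: harm_nonneg)
      finally show "(\<Sum>\<pi>\<in>?P. real (?miss \<pi>)) / card ?P \<le> 4 * (1 + harm k) * opt_cost n k \<sigma>"
        using finP by (simp add: card_gt_0_iff divide_le_eq mult.commute)
    qed simp
    \<comment> \<open>\<open>4 * (1 + harm k)\<close> is at most \<open>4 * (2 + ln k)\<close>, and
      \<open>2 + ln k\<close> is at most three times the maximum.\<close>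
    also have "\<dots> \<le> n * (12 * max 1 (ln (real k)) * opt_cost n k \<sigma>)"
      by (intro mult_left_mono mult_right_mono) (use harm_le_ln[OF k] in auto)
    finally show ?thesis by (simp add: mult_ac)
  qed
  ultimately show ?thesis unfolding randomized_competitive_def by blast
qed

(* The logarithm is bounded below by 1 so that the bound is not 0 for k = 1. For k >= 2 this
   only affects the constant C, since ln k >= ln 2. *)
theorem theorem7:
  "(\<forall>n\<ge>1. \<forall>k\<ge>1. \<exists>A. online_algorithm n k A \<and> competitive n k A (real (n * k))) \<and>
   (\<exists>C. \<forall>n\<ge>1. \<forall>k\<ge>1. \<exists>R. randomized_algorithm n k R \<and>
      randomized_competitive n k R (C * real n * max 1 (ln (real k))))"
  using deterministic_competitive randomized_algorithm_competitive by blast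

end
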